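(* Let $\mathcal{G}$ be an addable, minor-closed class of graphs. For every $k\in\mathbb{N}$ there exists a connected rooted graph $M_k\in\mathcal{G}$ such that for every connected graph $G\in\mathcal{G}$ that contains a pendant copy of $M_k$, we have $G\equiv^{\mathrm{MSO}}_k M_k$.
   Context: Minor-closed: closed under minors; decomposable: a graph is in the class iff all its components are; addable: decomposable and closed under adding an edge between vertices in distinct components. A rooted graph is a graph $H$ with a distinguished vertex $r$. $G$ contains a pendant copy of a connected rooted graph $H$ if $G$ has an induced subgraph isomorphic to $H$ such that there is exactly one edge between this copy and the rest of $G$, and this edge is incident with (the copy of) the root $r$. The quantifier depth of an MSO formula is the maximal nesting of quantifiers (vertex or set quantifiers). For graphs $G,H$, $G\equiv^{\mathrm{MSO}}_k H$ means every MSO sentence of quantifier depth at most $k$ holds in $G$ iff it holds in $H$. (MSO: first-order logic of graphs enriched with quantification over vertex sets and membership.) *)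

theory Defs
  imports "Graph_Theory.Digraph_Component" "Graph_Theory.Pair_Digraph"
    "Graph_Theory.Digraph_Isomorphism"
begin

text \<open>
  A finite simple graph is a \<^locale>\<open>pair_graph\<close>: an edge between u and v is the pair of arcs (u,v), (v,u).
  Classes of graphs consist of graphs on vertices of type \<^typ>\<open>nat\<close>, which loses nothing up to
  isomorphism. The graph without vertices is a graph, but it is not connected.
\<close>

type_synonym ngraph = "nat pair_pre_digraph"

definition graph_class :: "ngraph set \<Rightarrow> bool" where
  "graph_class \<C> \<longleftrightarrow> (\<forall>G\<in>\<C>. pair_graph G) \<and>
     (\<forall>G\<in>\<C>. \<forall>H. digraph_iso (with_proj G) (with_proj H) \<longrightarrow> H \<in> \<C>)"

definition delete_vertex :: "'a pair_pre_digraph \<Rightarrow> 'a \<Rightarrow> 'a pair_pre_digraph" where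
  "delete_vertex G v =
     \<lparr> pverts = pverts G - {v}, parcs = {(x, y) \<in> parcs G. x \<noteq> v \<and> y \<noteq> v} \<rparr>"

definition delete_edge :: "'a pair_pre_digraph \<Rightarrow> 'a \<Rightarrow> 'a \<Rightarrow> 'a pair_pre_digraph" where
  "delete_edge G u v = \<lparr> pverts = pverts G, parcs = parcs G - {(u, v), (v, u)} \<rparr>"

definition add_edge :: "'a pair_pre_digraph \<Rightarrow> 'a \<Rightarrow> 'a \<Rightarrow> 'a pair_pre_digraph" where
  "add_edge G u v = \<lparr> pverts = pverts G, parcs = parcs G \<union> {(u, v), (v, u)} \<rparr>"

text \<open>The vertex v is merged into u; loops and parallel edges that arise are suppressed.\<close>

definition contract_edge :: "'a pair_pre_digraph \<Rightarrow> 'a \<Rightarrow> 'a \<Rightarrow> 'a pair_pre_digraph" where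
  "contract_edge G u v =
     (let f = (\<lambda>x. if x = v then u else x)
      in \<lparr> pverts = pverts G - {v},
           parcs = {(f x, f y) | x y. (x, y) \<in> parcs G \<and> f x \<noteq> f y} \<rparr>)"

text \<open>Minors are taken literally here, not up to isomorphism; \<^const>\<open>graph_class\<close> supplies the latter.\<close>

inductive minor :: "'a pair_pre_digraph \<Rightarrow> 'a pair_pre_digraph \<Rightarrow> bool" where
  minor_refl: "minor G G"
| minor_delete_vertex: "minor H G \<Longrightarrow> v \<in> pverts H \<Longrightarrow> minor (delete_vertex H v) G"
| minor_delete_edge: "minor H G \<Longrightarrow> (u, v) \<in> parcs H \<Longrightarrow> minor (delete_edge H u v) G"
| minor_contract_edge: "minor H G \<Longrightarrow> (u, v) \<in> parcs H \<Longrightarrow> minor (contract_edge H u v) G"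

definition minor_closed :: "ngraph set \<Rightarrow> bool" where
  "minor_closed \<C> \<longleftrightarrow> (\<forall>G\<in>\<C>. \<forall>H. minor H G \<longrightarrow> H \<in> \<C>)"

text \<open>The strongly connected components of a symmetric digraph are its connected components.\<close>

definition components :: "'a pair_pre_digraph \<Rightarrow> 'a pair_pre_digraph set" where
  "components G = {H. with_proj H \<in> pre_digraph.sccs (with_proj G)}"

definition decomposable :: "ngraph set \<Rightarrow> bool" where
  "decomposable \<C> \<longleftrightarrow> (\<forall>G. pair_graph G \<longrightarrow> (G \<in> \<C> \<longleftrightarrow> (\<forall>H\<in>components G. H \<in> \<C>)))"

definition addable :: "ngraph set \<Rightarrow> bool" where
  "addable \<C> \<longleftrightarrow> decomposable \<C> \<and>
     (\<forall>G\<in>\<C>. \<forall>A\<in>components G. \<forall>B\<in>components G. A \<noteq> B \<longrightarrow>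
        (\<forall>u\<in>pverts A. \<forall>v\<in>pverts B. add_edge G u v \<in> \<C>))"

text \<open>
  The image of \<open>M\<close> under \<open>h\<close> is the copy. Each edge leaving the copy is represented by exactly one arc
  from inside to outside.
\<close>

definition contains_pendant_copy :: "'a pair_pre_digraph \<Rightarrow> 'b pair_pre_digraph \<Rightarrow> 'b \<Rightarrow> bool" where
  "contains_pendant_copy G M r \<longleftrightarrow>
     (\<exists>h C. pre_digraph.digraph_isomorphism (with_proj M) h \<and> C = app_iso h (with_proj M) \<and>
        induced_subgraph C (with_proj G) \<and>
        (\<exists>w. {(x, y) \<in> parcs G. x \<in> verts C \<and> y \<notin> verts C} = {(iso_verts h r, w)}))"

text \<open>
  MSO formulas of graphs. Individual and set variables are named by natural numbers, in two separate
  name spaces. The remaining connectives and the universal quantifiers are definable without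
  increasing the quantifier depth.
\<close>

datatype mso =
    Eq nat nat
  | Adj nat nat
  | Mem nat nat
  | Neg mso
  | Conj mso mso
  | Ex_vertex nat mso
  | Ex_set nat mso

primrec free_vertex_vars :: "mso \<Rightarrow> nat set" where
  "free_vertex_vars (Eq x y) = {x, y}"
| "free_vertex_vars (Adj x y) = {x, y}"
| "free_vertex_vars (Mem x X) = {x}"
| "free_vertex_vars (Neg \<phi>) = free_vertex_vars \<phi>"
| "free_vertex_vars (Conj \<phi> \<psi>) = free_vertex_vars \<phi> \<union> free_vertex_vars \<psi>"
| "free_vertex_vars (Ex_vertex x \<phi>) = free_vertex_vars \<phi> - {x}"
| "free_vertex_vars (Ex_set X \<phi>) = free_vertex_vars \<phi>"

primrec free_set_vars :: "mso \<Rightarrow> nat set" where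
  "free_set_vars (Eq x y) = {}"
| "free_set_vars (Adj x y) = {}"
| "free_set_vars (Mem x X) = {X}"
| "free_set_vars (Neg \<phi>) = free_set_vars \<phi>"
| "free_set_vars (Conj \<phi> \<psi>) = free_set_vars \<phi> \<union> free_set_vars \<psi>"
| "free_set_vars (Ex_vertex x \<phi>) = free_set_vars \<phi>"
| "free_set_vars (Ex_set X \<phi>) = free_set_vars \<phi> - {X}"

definition sentence :: "mso \<Rightarrow> bool" where
  "sentence \<phi> \<longleftrightarrow> free_vertex_vars \<phi> = {} \<and> free_set_vars \<phi> = {}"

primrec quantifier_depth :: "mso \<Rightarrow> nat" where
  "quantifier_depth (Eq x y) = 0"
| "quantifier_depth (Adj x y) = 0"
| "quantifier_depth (Mem x X) = 0"
| "quantifier_depth (Neg \<phi>) = quantifier_depth \<phi>"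
| "quantifier_depth (Conj \<phi> \<psi>) = max (quantifier_depth \<phi>) (quantifier_depth \<psi>)"
| "quantifier_depth (Ex_vertex x \<phi>) = Suc (quantifier_depth \<phi>)"
| "quantifier_depth (Ex_set X \<phi>) = Suc (quantifier_depth \<phi>)"

primrec sat :: "'a pair_pre_digraph \<Rightarrow> (nat \<Rightarrow> 'a) \<Rightarrow> (nat \<Rightarrow> 'a set) \<Rightarrow> mso \<Rightarrow> bool" where
  "sat G s S (Eq x y) \<longleftrightarrow> s x = s y"
| "sat G s S (Adj x y) \<longleftrightarrow> (s x, s y) \<in> parcs G"
| "sat G s S (Mem x X) \<longleftrightarrow> s x \<in> S X"
| "sat G s S (Neg \<phi>) \<longleftrightarrow> \<not> sat G s S \<phi>"
| "sat G s S (Conj \<phi> \<psi>) \<longleftrightarrow> sat G s S \<phi> \<and> sat G s S \<psi>"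
| "sat G s S (Ex_vertex x \<phi>) \<longleftrightarrow> (\<exists>a\<in>pverts G. sat G (s(x := a)) S \<phi>)"
| "sat G s S (Ex_set X \<phi>) \<longleftrightarrow> (\<exists>A\<subseteq>pverts G. sat G s (S(X := A)) \<phi>)"

text \<open>Only used for sentences, whose truth does not depend on the assignment chosen here.\<close>

definition holds_in :: "mso \<Rightarrow> 'a pair_pre_digraph \<Rightarrow> bool" where
  "holds_in \<phi> G \<longleftrightarrow> sat G (\<lambda>_. undefined) (\<lambda>_. {}) \<phi>"

definition mso_equiv :: "nat \<Rightarrow> 'a pair_pre_digraph \<Rightarrow> 'b pair_pre_digraph \<Rightarrow> bool" where
  "mso_equiv k G H \<longleftrightarrow>
     (\<forall>\<phi>. sentence \<phi> \<and> quantifier_depth \<phi> \<le> k \<longrightarrow> (holds_in \<phi> G \<longleftrightarrow> holds_in \<phi> H))"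

end

theory Submission
  imports Defs "HOL-Library.Nat_Bijection"
begin

text \<open>
  Graphs are compared by coded rank-\<open>j\<close> types of a set-only Ehrenfeucht-Fraisse game; an individual
  variable is played as a singleton set. If a graph consists of a root \<open>r\<close> and mutually
  nonadjacent blocks, its type is determined by the root together with the number of blocks of each
  type, counted up to a threshold. Let \<open>M\<close> consist of a root with threshold-many blocks of every type
  realised by a rooted connected graph in the class. In a connected graph with a pendant copy of \<open>M\<close>,
  the rest of the graph is just one more block at the root, whose type already occurs often enough.
\<close>

subsection \<open>Counting up to a threshold\<close>

text \<open>Once the neighbourhood of the root is kept as one of the sets, everything a block shares
  with the rest of the graph shows in its own colours, so a move can be answered block by block. A
  set move retypes all blocks at once and splits a class of blocks of equal type into at most
  \<open>card (types k j)\<close> subclasses. For the new counts to agree up to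
  \<open>threshold k j\<close>, the old ones must agree up to about that many times more, hence the
  product in \<open>threshold\<close>. It starts at 2 because atomic types record which colours
  occur twice, possibly in two blocks of equal type; that record is what recognises singletons, the
  price of playing vertices as sets.

  The two closure properties act from opposite sides. Addability allows \<open>M\<close> to be
  assembled inside the class from any of its rooted connected members. Minor-closedness puts the
  rest of a graph around the copy back into the class: it is an induced subgraph, and connected
  because only one edge leaves it. So its type was available when \<open>M\<close> was
  built.\<close>

definition eq_upto :: "nat \<Rightarrow> nat \<Rightarrow> nat \<Rightarrow> bool" where
  "eq_upto m x y \<longleftrightarrow> x = y \<or> m \<le> x \<and> m \<le> y"

definition matched :: "nat \<Rightarrow> 'a set \<Rightarrow> ('a \<Rightarrow> 'c) \<Rightarrow> 'b set \<Rightarrow> ('b \<Rightarrow> 'c) \<Rightarrow> bool" where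
  "matched m P f Q g \<longleftrightarrow> (\<forall>c. eq_upto m (card {x \<in> P. f x = c}) (card {y \<in> Q. g y = c}))"

lemma eq_upto_sym: "eq_upto m x y \<Longrightarrow> eq_upto m y x"
  by (auto simp: eq_upto_def)

lemma matched_sym: "matched m P f Q g \<Longrightarrow> matched m Q g P f"
  by (simp add: matched_def eq_upto_sym)

lemma matched_le_card:
  assumes "matched m P f Q g" "n \<le> m" "n \<le> card {x \<in> P. f x = c}"
  shows "n \<le> card {y \<in> Q. g y = c}"
proof -
  have "eq_upto m (card {x \<in> P. f x = c}) (card {y \<in> Q. g y = c})"
    using assms(1) by (simp add: matched_def)
  then show ?thesis using assms(2,3) by (auto simp: eq_upto_def)
qed

lemma matched_ex:
  assumes "matched m P f Q g" "finite P" "1 \<le> m" "x \<in> P"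
  shows "\<exists>y\<in>Q. g y = f x"
proof -
  have "card {z \<in> P. f z = f x} > 0"
    using assms(2,4) by (auto simp: card_gt_0_iff)
  then have "card {y \<in> Q. g y = f x} > 0"
    using matched_le_card[OF assms(1,3), of "f x"] by simp
  then show ?thesis by (auto simp: card_gt_0_iff)
qed

text \<open>The delicate case is two elements of one colour, where the class on the other side must
  itself reach 2; different colours give different partners for free.\<close>

lemma matched_ex2:
  assumes "matched m P f Q g" "finite P" "2 \<le> m" "x1 \<in> P" "x2 \<in> P" "x1 \<noteq> x2"
  shows "\<exists>y1\<in>Q. \<exists>y2\<in>Q. y1 \<noteq> y2 \<and> g y1 = f x1 \<and> g y2 = f x2"
proof (cases "f x1 = f x2")
  case True
  have "card {x1, x2} \<le> card {z \<in> P. f z = f x1}"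
    using assms True by (intro card_mono) auto
  then have "2 \<le> card {z \<in> P. f z = f x1}" using assms(6) by simp
  then have c: "2 \<le> card {y \<in> Q. g y = f x1}"
    by (rule matched_le_card[OF assms(1,3)])
  then obtain T where "T \<subseteq> {y \<in> Q. g y = f x1}" "card T = 2"
    by (meson obtain_subset_with_card_n)
  then show ?thesis using True by (auto simp: card_2_iff)
next
  case False
  have "1 \<le> m" using assms(3) by simp
  from matched_ex[OF assms(1,2) this assms(4)] matched_ex[OF assms(1,2) this assms(5)]
  obtain y1 y2 where "y1 \<in> Q" "g y1 = f x1" "y2 \<in> Q" "g y2 = f x2" by blast
  moreover from this False have "y1 \<noteq> y2" by auto
  ultimately show ?thesis by blast
qed

text \<open>If \<open>P\<close> and \<open>Q\<close> have equal size, \<open>f\<close> is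
  transported along a bijection. Otherwise both are large, and by pigeonhole some colour
  \<open>c0\<close> has a class of size at least \<open>m\<close>: a sample of at most
  \<open>m\<close> elements per colour is embedded into \<open>Q\<close>, and all leftover elements
  get \<open>c0\<close>, whose count is beyond the range of comparison anyway.\<close>

lemma recolour_class:
  assumes fin: "finite P" "finite Q" "finite C" and f: "f ` P \<subseteq> C"
    and eq: "eq_upto (m * Suc (card C)) (card P) (card Q)" and m: "1 \<le> m"
  shows "\<exists>g. g ` Q \<subseteq> f ` P \<and> matched m P f Q g"
proof (cases "card P = card Q")
  case True
  then obtain h where h: "bij_betw h Q P"
    using fin by (metis finite_same_card_bij)
  have "card {x \<in> P. f x = c} = card {y \<in> Q. (f \<circ> h) y = c}" for c
  proof -
    have "{x \<in> P. f x = c} = h ` {y \<in> Q. (f \<circ> h) y = c}"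
      using bij_betw_imp_surj_on[OF h] by auto
    moreover have "inj_on h {y \<in> Q. (f \<circ> h) y = c}"
      using bij_betw_imp_inj_on[OF h] by (rule inj_on_subset) blast
    ultimately show ?thesis by (simp only: card_image)
  qed
  then have "matched m P f Q (f \<circ> h)" by (auto simp: matched_def eq_upto_def)
  moreover have "(f \<circ> h) ` Q \<subseteq> f ` P" using h by (auto simp: bij_betw_def)
  ultimately show ?thesis by blast
next
  case False
  then have big: "m * Suc (card C) \<le> card P" "m * Suc (card C) \<le> card Q"
    using eq by (auto simp: eq_upto_def)
  let ?P = "\<lambda>c. {x \<in> P. f x = c}"
  have P_Un: "P = (\<Union>c\<in>C. ?P c)" using f by auto
  have "\<exists>c0\<in>C. m \<le> card (?P c0)"
  proof (rule ccontr)
    assume "\<not> ?thesis"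
    then have le: "card (?P c) \<le> m" if "c \<in> C" for c using that by (meson nat_le_linear)
    have "card P = card (\<Union>c\<in>C. ?P c)" by (rule arg_cong[OF P_Un])
    also have "\<dots> \<le> (\<Sum>c\<in>C. card (?P c))" by (rule card_UN_le[OF fin(3)])
    also have "\<dots> \<le> (\<Sum>c\<in>C. m)" by (rule sum_mono[OF le])
    \<comment> \<open>The part beyond \<open>m * card C\<close> makes the pigeonhole strict; this is
      the origin of \<open>Suc (card C)\<close>.\<close>
    finally show False using big(1) m by (simp add: mult.commute)
  qed
  then obtain c0 where c0: "m \<le> card (?P c0)" by blast
  have "\<exists>T. T \<subseteq> ?P c \<and> card T = min m (card (?P c))" for c
    by (meson obtain_subset_with_card_n min.cobounded2)
  then obtain T where T: "\<And>c. T c \<subseteq> ?P c" "\<And>c. card (T c) = min m (card (?P c))" by metis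
  let ?U = "\<Union>c\<in>C. T c"
  have finU: "finite ?U" using T(1) fin by (auto intro: finite_subset)
  have "card ?U \<le> (\<Sum>c\<in>C. card (T c))" using fin by (simp add: card_UN_le)
  also have "\<dots> \<le> (\<Sum>c\<in>C. m)" by (intro sum_mono) (simp add: T)
  also have "\<dots> \<le> card Q" using big(2) by (simp add: algebra_simps)
  finally obtain i where i: "inj_on i ?U" "i ` ?U \<subseteq> Q"
    using card_le_inj[OF finU fin(2)] by blast
  define g where "g y = (if y \<in> i ` ?U then f (inv_into ?U i y) else c0)" for y
  have gi: "g (i x) = f x" if "x \<in> ?U" for x
    using that i(1) unfolding g_def by auto
  have "f ` ?U \<subseteq> f ` P" using T(1) by blast
  moreover have "c0 \<in> f ` P"
    using c0 m by (metis (mono_tags, lifting) One_nat_def card_eq_0_iff empty_Collect_eq imageI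
        le_zero_eq nat.distinct(1))
  ultimately have "g y \<in> f ` P" for y
    using inv_into_into[of y i ?U] by (auto simp: g_def simp del: UN_iff image_eqI)
  then have sub: "g ` Q \<subseteq> f ` P" by blast
  have img: "i ` T c \<subseteq> {y \<in> Q. g y = c}" if "c \<in> C" for c
  proof
    fix y assume "y \<in> i ` T c"
    then obtain x where x: "x \<in> T c" "y = i x" by blast
    then have "x \<in> ?U" using that by blast
    moreover have "f x = c" using x T(1) by blast
    ultimately show "y \<in> {y \<in> Q. g y = c}" using gi x i(2) by auto
  qed
  have cardi: "card (i ` T c) = min m (card (?P c))" if "c \<in> C" for c
    using that i(1) T(2) by (metis (no_types, lifting) SUP_upper card_image inj_on_subset)
  have "eq_upto m (card (?P c)) (card {y \<in> Q. g y = c})" for c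
  proof (cases "c \<in> C")
    case C: True
    have le: "min m (card (?P c)) \<le> card {y \<in> Q. g y = c}"
      using card_mono[OF _ img[OF C]] fin cardi[OF C] by simp
    show ?thesis
    proof (cases "m \<le> card (?P c)")
      case True
      then show ?thesis using le by (auto simp: eq_upto_def)
    next
      case False
      \<comment> \<open>A small class is not that of \<open>c0\<close>, so it receives no leftovers
        and consists of its sample alone.\<close>
      then have "c \<noteq> c0" using c0 by auto
      have "{y \<in> Q. g y = c} \<subseteq> i ` T c"
      proof
        fix y assume y: "y \<in> {y \<in> Q. g y = c}"
        then have "y \<in> i ` ?U" using \<open>c \<noteq> c0\<close> by (auto simp: g_def split: if_splits)
        then obtain x d where x: "x \<in> T d" "d \<in> C" "y = i x" by blast
        then have "x \<in> ?U" by blast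
          then have "f x = c" using gi[of x] y x(3) by simp
        then have "d = c" using x T(1) by auto
        then show "y \<in> i ` T c" using x by simp
      qed
      then have "{y \<in> Q. g y = c} = i ` T c" using img[OF C] by blast
      then show ?thesis using cardi[OF C] False by (simp add: eq_upto_def)
    qed
  next
    case False
    have "card (?P c) = 0" using f False by (intro card_eq_0_iff[THEN iffD2]) blast
    moreover have "card {y \<in> Q. g y = c} = 0"
      using f sub False by (intro card_eq_0_iff[THEN iffD2]) blast
    ultimately show ?thesis by (simp add: eq_upto_def)
  qed
  then show ?thesis using sub by (auto simp: matched_def)
qed

text \<open>Either all summands agree, or one reaches \<open>m\<close> on both sides and with it
  both sums.\<close>

lemma eq_upto_sum:
  assumes "finite T" "\<And>t. t \<in> T \<Longrightarrow> eq_upto m (x t) (y t)"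
  shows "eq_upto m (sum x T) (sum y T)"
proof (cases "\<forall>t\<in>T. x t = y t")
  case False
  then obtain t where t: "t \<in> T" "m \<le> x t" "m \<le> y t" using assms(2) by (auto simp: eq_upto_def)
  then have "m \<le> sum x T" "m \<le> sum y T"
    using assms(1) by (metis member_le_sum le_trans zero_le)+
  then show ?thesis by (simp add: eq_upto_def)
qed (simp add: eq_upto_def)

lemma card_split:
  assumes "finite A" "finite T" "K ` A \<subseteq> T"
  shows "card {x \<in> A. k x = c} = (\<Sum>t\<in>T. card {x \<in> {x \<in> A. K x = t}. k x = c})"
proof -
  have "{x \<in> A. k x = c} = (\<Union>t\<in>T. {x \<in> {x \<in> A. K x = t}. k x = c})" using assms by auto
  moreover have "card \<dots> = (\<Sum>t\<in>T. card {x \<in> {x \<in> A. K x = t}. k x = c})"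
    using assms by (intro card_UN_disjoint) auto
  ultimately show ?thesis by simp
qed

text \<open>\<open>recolour_class\<close> is applied inside every class of the coarser colourings
  \<open>F\<close> and \<open>G\<close>, and the counts are summed over these classes. The second
  conclusion keeps each new colour compatible with the old one; it is what later makes the types
  prescribed by \<open>g\<close> attainable by a move.\<close>

lemma recolour:
  assumes fin: "finite P" "finite Q" "finite C" and f: "f ` P \<subseteq> C"
    and FG: "matched (m * Suc (card C)) P F Q G" and m: "1 \<le> m"
  shows "\<exists>g. matched m P f Q g \<and> (\<forall>y\<in>Q. \<exists>x\<in>P. F x = G y \<and> f x = g y)"
proof -
  have "\<forall>t. \<exists>g. g ` {y \<in> Q. G y = t} \<subseteq> f ` {x \<in> P. F x = t} \<and>
     matched m {x \<in> P. F x = t} f {y \<in> Q. G y = t} g"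
    using fin f FG m by (intro allI recolour_class[of _ _ C]) (auto simp: matched_def)
  from choice[OF this] obtain h where h0: "\<forall>t. h t ` {y \<in> Q. G y = t} \<subseteq> f ` {x \<in> P. F x = t} \<and>
     matched m {x \<in> P. F x = t} f {y \<in> Q. G y = t} (h t)" ..
  have h: "h t ` {y \<in> Q. G y = t} \<subseteq> f ` {x \<in> P. F x = t}"
    "matched m {x \<in> P. F x = t} f {y \<in> Q. G y = t} (h t)" for t
    using h0[rule_format, of t] by simp_all
  define g where "g y = h (G y) y" for y
  let ?T = "F ` P \<union> G ` Q"
  have T: "finite ?T" using fin by simp
  have "eq_upto m (card {x \<in> P. f x = c}) (card {y \<in> Q. g y = c})" for c
  proof -
    have "eq_upto m (card {x \<in> {x \<in> P. F x = t}. f x = c}) (card {x \<in> {x \<in> Q. G x = t}. g x = c})" for t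
    proof -
      have "{x \<in> {x \<in> Q. G x = t}. g x = c} = {x \<in> {x \<in> Q. G x = t}. h t x = c}"
        by (auto simp: g_def)
      then show ?thesis using h(2)[of t] by (simp add: matched_def)
    qed
    then have "eq_upto m (\<Sum>t\<in>?T. card {x \<in> {x \<in> P. F x = t}. f x = c})
        (\<Sum>t\<in>?T. card {x \<in> {x \<in> Q. G x = t}. g x = c})"
      by (intro eq_upto_sum T)
    moreover have "card {x \<in> P. f x = c} = (\<Sum>t\<in>?T. card {x \<in> {x \<in> P. F x = t}. f x = c})"
      using fin by (intro card_split) auto
    moreover have "card {x \<in> Q. g x = c} = (\<Sum>t\<in>?T. card {x \<in> {x \<in> Q. G x = t}. g x = c})"
      using fin by (intro card_split) auto
    ultimately show ?thesis by simp
  qed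
  moreover have "\<exists>x\<in>P. F x = G y \<and> f x = g y" if "y \<in> Q" for y
  proof -
    have "g y \<in> f ` {x \<in> P. F x = G y}" using h(1)[of "G y"] that unfolding g_def by blast
    then show ?thesis by auto
  qed
  ultimately show ?thesis unfolding matched_def by blast
qed

subsection \<open>Types of vertex-coloured graphs\<close>

text \<open>Colours and types are coded as natural numbers: types of all ranks, of graphs over
  different vertex types, then live in one HOL type and can be compared.\<close>

definition colour :: "nat \<Rightarrow> (nat \<Rightarrow> 'a set) \<Rightarrow> 'a \<Rightarrow> nat" where
  "colour k S v = set_encode {i. i \<le> k \<and> v \<in> S i}"

lemma in_colour: "i \<in> set_decode (colour k S v) \<longleftrightarrow> i \<le> k \<and> v \<in> S i"
  by (simp add: colour_def)

lemma colour_eq_iff: "colour k S v = colour k S' v' \<longleftrightarrow> (\<forall>i\<le>k. v \<in> S i \<longleftrightarrow> v' \<in> S' i)"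
proof
  assume "colour k S v = colour k S' v'"
  then show "\<forall>i\<le>k. v \<in> S i \<longleftrightarrow> v' \<in> S' i" by (metis in_colour)
next
  assume "\<forall>i\<le>k. v \<in> S i \<longleftrightarrow> v' \<in> S' i"
  then have "{i. i \<le> k \<and> v \<in> S i} = {i. i \<le> k \<and> v' \<in> S' i}" by auto
  then show "colour k S v = colour k S' v'" by (simp add: colour_def)
qed

definition colours :: "nat \<Rightarrow> nat set" where
  "colours k = set_encode ` Pow {..k}"

lemma finite_colours: "finite (colours k)" by (simp add: colours_def)

lemma colour_in_colours: "colour k S v \<in> colours k"
  unfolding colour_def colours_def by (rule imageI) auto

text \<open>\<open>R\<close> is cut down to \<open>V\<close> here, so all blocks of a graph can be
  typed with the arc relation of the whole graph.\<close>

definition arc_colours :: "nat \<Rightarrow> 'a set \<Rightarrow> 'a rel \<Rightarrow> (nat \<Rightarrow> 'a set) \<Rightarrow> nat set" where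
  "arc_colours k V R S =
     {prod_encode (colour k S u, colour k S v) | u v. u \<in> V \<and> v \<in> V \<and> (u, v) \<in> R}"

lemma arc_coloursI:
  "u \<in> V \<Longrightarrow> v \<in> V \<Longrightarrow> (u, v) \<in> R \<Longrightarrow> c = colour k S u \<Longrightarrow> d = colour k S v \<Longrightarrow>
     prod_encode (c, d) \<in> arc_colours k V R S"
  unfolding arc_colours_def by blast

text \<open>Counting colours up to two is enough to tell whether a set has exactly one element; see
  \<open>singleton_iff_colour\<close>.\<close>

definition repeated_colours :: "nat \<Rightarrow> 'a set \<Rightarrow> (nat \<Rightarrow> 'a set) \<Rightarrow> nat set" where
  "repeated_colours k V S = {c. \<exists>u\<in>V. \<exists>v\<in>V. u \<noteq> v \<and> colour k S u = c \<and> colour k S v = c}"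

definition atomic_type :: "nat \<Rightarrow> 'a set \<Rightarrow> 'a rel \<Rightarrow> (nat \<Rightarrow> 'a set) \<Rightarrow> nat" where
  "atomic_type k V R S = prod_encode (set_encode (colour k S ` V),
     prod_encode (set_encode (arc_colours k V R S), set_encode (repeated_colours k V S)))"

lemma colour_image_sub: "colour k S ` V \<subseteq> colours k"
  by (simp add: image_subset_iff colour_in_colours)

lemma arc_colours_sub: "arc_colours k V R S \<subseteq> prod_encode ` (colours k \<times> colours k)"
  unfolding arc_colours_def by (auto simp: colour_in_colours)

lemma repeated_colours_sub: "repeated_colours k V S \<subseteq> colours k"
  unfolding repeated_colours_def by (auto simp: colour_in_colours)

lemma finite_colour_image: "finite (colour k S ` V)"
  using colour_image_sub finite_colours by (rule finite_subset)

lemma finite_arc_colours: "finite (arc_colours k V R S)"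
  using arc_colours_sub by (rule finite_subset) (simp add: finite_colours)

lemma finite_repeated_colours: "finite (repeated_colours k V S)"
  using repeated_colours_sub finite_colours by (rule finite_subset)

lemma atomic_type_eq_iff:
  "atomic_type k V R S = atomic_type k V' R' S' \<longleftrightarrow>
     colour k S ` V = colour k S' ` V' \<and> arc_colours k V R S = arc_colours k V' R' S' \<and>
     repeated_colours k V S = repeated_colours k V' S'"
  unfolding atomic_type_def
  by (simp add: set_encode_eq finite_colour_image finite_arc_colours finite_repeated_colours)

text \<open>A finite range for \<open>ty\<close> that depends on \<open>k\<close> and
  \<open>j\<close> alone, so that thresholds can be fixed before any graph is chosen.\<close>

primrec types :: "nat \<Rightarrow> nat \<Rightarrow> nat set" where
  "types k 0 = prod_encode ` (set_encode ` Pow (colours k) \<times>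
     prod_encode ` (set_encode ` Pow (prod_encode ` (colours k \<times> colours k)) \<times>
       set_encode ` Pow (colours k)))"
| "types k (Suc j) = set_encode ` Pow (types k j)"

lemma finite_types: "finite (types k j)"
  by (induction j) (auto simp: finite_colours)

text \<open>
  The move with \<open>j + 1\<close> rounds left overwrites the set variable \<open>j\<close>, so a type of rank \<open>j\<close> only depends
  on the sets \<open>S i\<close> with \<open>j \<le> i \<le> k\<close>. The sets are not confined to \<open>V\<close>; only their traces on
  \<open>V\<close> matter, which lets all blocks of a graph share one assignment. In \<open>k\<close> rounds the variable \<open>k\<close> is
  never overwritten; it is reserved for the set of neighbours of the root.
\<close>

primrec ty :: "nat \<Rightarrow> nat \<Rightarrow> 'a set \<Rightarrow> 'a rel \<Rightarrow> (nat \<Rightarrow> 'a set) \<Rightarrow> nat" where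
  "ty k 0 V R S = atomic_type k V R S"
| "ty k (Suc j) V R S = set_encode (range (\<lambda>A. ty k j V R (S(j := A))))"

lemma ty_in_types: "ty k j V R S \<in> types k j"
proof (induction j arbitrary: S)
  case 0
  show ?case
    unfolding atomic_type_def ty.simps types.simps
    by (intro imageI SigmaI PowI colour_image_sub arc_colours_sub repeated_colours_sub)
next
  case (Suc j)
  then show ?case by (auto intro!: imageI)
qed

text \<open>\<open>A\<close> may range over infinitely many sets, while \<open>set_encode\<close> is
  faithful on finite sets only.\<close>

lemma finite_range_ty: "finite (range (\<lambda>A. ty k j V R (S(j := A))))"
  by (rule finite_subset[OF _ finite_types[of k j]]) (auto simp: ty_in_types)

lemma ty_Suc_eq_iff:
  "ty k (Suc j) V R S = ty k (Suc j) V' R' S' \<longleftrightarrow>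
     range (\<lambda>A. ty k j V R (S(j := A))) = range (\<lambda>A. ty k j V' R' (S'(j := A)))"
  by (simp add: set_encode_eq finite_range_ty)

lemma ty_Suc_extend:
  assumes "ty k (Suc j) V R S = ty k (Suc j) V' R' S'"
  obtains A' where "ty k j V R (S(j := A)) = ty k j V' R' (S'(j := A'))"
  using assms unfolding ty_Suc_eq_iff by blast

text \<open>An isomorphism carries every move to a move. With \<open>h = id\<close> the lemma also
  says that a type depends only on the traces of the sets and arcs on \<open>V\<close>.\<close>

lemma ty_iso:
  assumes h: "bij_betw h V V'"
    and R: "\<And>u v. u \<in> V \<Longrightarrow> v \<in> V \<Longrightarrow> (u, v) \<in> R \<longleftrightarrow> (h u, h v) \<in> R'"
    and S: "\<And>i v. j \<le> i \<Longrightarrow> i \<le> k \<Longrightarrow> v \<in> V \<Longrightarrow> v \<in> S i \<longleftrightarrow> h v \<in> S' i"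
  shows "ty k j V R S = ty k j V' R' S'"
  using S
proof (induction j arbitrary: S S')
  case 0
  have V': "V' = h ` V" and inj: "inj_on h V" using h by (auto simp: bij_betw_def)
  have col: "colour k S v = colour k S' (h v)" if "v \<in> V" for v
    using 0 that by (simp add: colour_eq_iff)
  have "colour k S ` V = colour k S' ` V'"
    unfolding V' image_image using col by (intro image_cong) auto
  moreover have "arc_colours k V R S = arc_colours k V' R' S'"
    unfolding arc_colours_def V' using col R by (auto; metis imageI)
  moreover have "repeated_colours k V S = repeated_colours k V' S'"
    unfolding repeated_colours_def V' using col inj by (auto simp: inj_on_eq_iff)
  ultimately show ?case by (simp add: atomic_type_eq_iff)
next
  case (Suc j)
  have inj: "inj_on h V" and V': "V' = h ` V" using h by (auto simp: bij_betw_def)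
  \<comment> \<open>\<open>h\<close> is injective on \<open>V\<close> only, so a move is cut down to
    \<open>V\<close> before its image is taken; in the other direction the preimage serves.\<close>
  have 1: "ty k j V R (S(j := A)) = ty k j V' R' (S'(j := h ` (A \<inter> V)))" for A
    using Suc.prems inj by (intro Suc.IH) (auto simp: inj_on_eq_iff)
  have 2: "ty k j V' R' (S'(j := A)) = ty k j V R (S(j := h -` A))" for A
    using Suc.prems by (intro Suc.IH[symmetric]) auto
  show ?case unfolding ty_Suc_eq_iff using 1 2 by (auto simp: image_iff)
qed

subsection \<open>Composition of types around a root\<close>

text \<open>Each block is a union of components of what remains without the root. Arcs at the root
  are left open; the set with index \<open>k\<close> will describe them.\<close>

definition star :: "'a set \<Rightarrow> 'a rel \<Rightarrow> 'a \<Rightarrow> 'a set set \<Rightarrow> bool" where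
  "star V R r P \<longleftrightarrow> finite P \<and> V = insert r (\<Union>P) \<and> r \<notin> \<Union>P \<and> pairwise disjnt P \<and> sym R \<and>
     (r, r) \<notin> R \<and> (\<forall>u\<in>\<Union>P. \<forall>v\<in>\<Union>P. (u, v) \<in> R \<longrightarrow> (\<exists>B\<in>P. u \<in> B \<and> v \<in> B))"

text \<open>The bound required by \<open>recolour\<close> when blocks alike at rank
  \<open>j + 1\<close> are split by their types of rank \<open>j\<close>. The start 2 is what
  \<open>matched_ex2\<close> asks for.\<close>

primrec threshold :: "nat \<Rightarrow> nat \<Rightarrow> nat" where
  "threshold k 0 = 2"
| "threshold k (Suc j) = threshold k j * Suc (card (types k j))"

lemma threshold_pos: "1 \<le> threshold k j"
  by (induction j) auto

text \<open>A block has a partner of the same atomic type, two distinct blocks have distinct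
  partners, and adjacency to the root is bit \<open>k\<close> of the colour; this covers every
  position of a vertex, an arc or a pair of equally coloured vertices. Inclusions suffice, as the
  hypotheses are symmetric.\<close>

lemma atomic_type_star_le:
  assumes G: "star V R r P" and G': "star V' R' r' P'"
    and Sk: "\<And>v. v \<in> V \<Longrightarrow> v \<in> S k \<longleftrightarrow> (r, v) \<in> R" and Sk': "\<And>v. v \<in> V' \<Longrightarrow> v \<in> S' k \<longleftrightarrow> (r', v) \<in> R'"
    and r: "colour k S r = colour k S' r'"
    and m: "matched 2 P (\<lambda>B. atomic_type k B R S) P' (\<lambda>B. atomic_type k B R' S')"
  shows "colour k S ` V \<subseteq> colour k S' ` V'" "arc_colours k V R S \<subseteq> arc_colours k V' R' S'"
    "repeated_colours k V S \<subseteq> repeated_colours k V' S'"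
proof -
  have fin: "finite P" and V: "V = insert r (\<Union>P)" and V': "V' = insert r' (\<Union>P')" 
    and rP: "r \<notin> \<Union>P" "r' \<notin> \<Union>P'" and disj': "pairwise disjnt P'"
    and symR: "sym R" "sym R'" and loop: "(r, r) \<notin> R"
    and arcs: "\<And>u v. u \<in> \<Union>P \<Longrightarrow> v \<in> \<Union>P \<Longrightarrow> (u, v) \<in> R \<Longrightarrow> \<exists>B\<in>P. u \<in> B \<and> v \<in> B"
    using G G' unfolding star_def by blast+
  have blk: "\<exists>B'\<in>P'. colour k S ` B = colour k S' ` B' \<and>
      arc_colours k B R S = arc_colours k B' R' S' \<and>
      repeated_colours k B S = repeated_colours k B' S'" if "B \<in> P" for B
  proof -
    obtain B' where "B' \<in> P'" "atomic_type k B' R' S' = atomic_type k B R S"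
      using matched_ex[OF m fin _ \<open>B \<in> P\<close>] by auto
    then show ?thesis unfolding atomic_type_eq_iff by (intro bexI[of _ B']) simp_all
  qed
  have blkv: "\<exists>B'\<in>P'. \<exists>v'\<in>B'. colour k S v = colour k S' v'" if Bv: "B \<in> P" "v \<in> B" for B v
  proof -
    obtain B' where "B' \<in> P'" "colour k S ` B = colour k S' ` B'" using blk[OF Bv(1)] by blast
    moreover have "colour k S v \<in> colour k S ` B" using Bv(2) by (rule imageI)
    ultimately show ?thesis by (metis imageE)
  qed
  show "colour k S ` V \<subseteq> colour k S' ` V'"
    unfolding V V' using r blkv by (force simp: image_iff)
  show "arc_colours k V R S \<subseteq> arc_colours k V' R' S'"
  proof
    fix c assume "c \<in> arc_colours k V R S"
    then obtain u v where uv: "u \<in> V" "v \<in> V" "(u, v) \<in> R" "c = prod_encode (colour k S u, colour k S v)"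
      unfolding arc_colours_def by blast
    have root: "\<exists>v'\<in>\<Union>P'. (r', v') \<in> R' \<and> colour k S v = colour k S' v'" if v: "v \<in> V" "(r, v) \<in> R" for v
    proof -
      have "v \<noteq> r" using loop v(2) by auto
      then obtain B where "B \<in> P" "v \<in> B" using v(1) V by blast
      then obtain B' v' where v': "B' \<in> P'" "v' \<in> B'" "colour k S v = colour k S' v'" using blkv by blast
      \<comment> \<open>Index \<open>k\<close> of the colour records adjacency to the root on either
        side, so equal colours transfer the arc.\<close>
      have "v \<in> S k" using Sk v by blast
      then have "v' \<in> S' k" using v'(3) unfolding colour_eq_iff by simp
      then have "(r', v') \<in> R'" using Sk' v'(1,2) V' by blast
      then show ?thesis using v' by blast
    qed
    have r': "r' \<in> V'" using V' by simp
    consider "u = r" | "v = r" | "u \<in> \<Union>P" "v \<in> \<Union>P" using uv V by blast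
    then show "c \<in> arc_colours k V' R' S'"
    proof cases
      case 1
      with uv(3) have "(r, v) \<in> R" by simp
      then obtain v' where v': "v' \<in> \<Union>P'" "(r', v') \<in> R'" "colour k S v = colour k S' v'"
        using root uv(2) by blast
      then have "v' \<in> V'" using V' by simp
      then show ?thesis unfolding uv(4) using r' v'(2,3) r 1 by (intro arc_coloursI) simp_all
    next
      case 2
      then have "(r, u) \<in> R" using uv symR(1) by (meson symD)
      then obtain u' where u': "u' \<in> \<Union>P'" "(r', u') \<in> R'" "colour k S u = colour k S' u'"
        using root uv(1) by blast
      have "(u', r') \<in> R'" using u'(2) symR(2) by (meson symD)
      moreover have "u' \<in> V'" using u'(1) V' by simp
      ultimately show ?thesis unfolding uv(4) using r' u'(3) r 2
        by (intro arc_coloursI[of u' _ r']) simp_all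
    next
      case 3
      then obtain B where B: "B \<in> P" "u \<in> B" "v \<in> B" using arcs uv(3) by blast
      then have "c \<in> arc_colours k B R S" using uv unfolding arc_colours_def by blast
      then obtain B' where "B' \<in> P'" "c \<in> arc_colours k B' R' S'" using blk B(1) by blast
      then show ?thesis unfolding arc_colours_def V' by blast
    qed
  qed
  show "repeated_colours k V S \<subseteq> repeated_colours k V' S'"
  proof
    fix c assume "c \<in> repeated_colours k V S"
    then obtain u v where uv: "u \<in> V" "v \<in> V" "u \<noteq> v" "colour k S u = c" "colour k S v = c"
      unfolding repeated_colours_def by blast
    have root: "c \<in> repeated_colours k V' S'" if v: "v \<in> \<Union>P" "colour k S v = c" "colour k S r = c" for v
    proof -
      obtain v' where v': "v' \<in> \<Union>P'" "c = colour k S' v'" using blkv v by blast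
      moreover have "r' \<noteq> v'" using v'(1) rP by blast
      moreover have "r' \<in> V'" "v' \<in> V'" using v'(1) V' by simp_all
      ultimately show ?thesis using r v(3) unfolding repeated_colours_def
        by (intro CollectI bexI[of _ r'] bexI[of _ v']) simp_all
    qed
    consider "u = r" "v \<in> \<Union>P" | "v = r" "u \<in> \<Union>P" | B where "B \<in> P" "u \<in> B" "v \<in> B"
      | B1 B2 where "B1 \<in> P" "B2 \<in> P" "B1 \<noteq> B2" "u \<in> B1" "v \<in> B2"
      using uv V by blast
    then show "c \<in> repeated_colours k V' S'"
    proof cases
      case 1 then show ?thesis using root uv by blast
    next
      case 2 then show ?thesis using root uv by blast
    next
      case 3
      then have "c \<in> repeated_colours k B S" using uv unfolding repeated_colours_def by blast
      then obtain B' where "B' \<in> P'" "c \<in> repeated_colours k B' S'" using blk 3(1) by blast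
      then show ?thesis unfolding repeated_colours_def V' by blast
    next
      \<comment> \<open>The two blocks may have the same type, so two distinct partners must be
        found; disjointness then separates the two vertices.\<close>
      case 4
      from matched_ex2[OF m fin _ 4(1-3)] obtain B1' B2'
        where B': "B1' \<in> P'" "B2' \<in> P'" "B1' \<noteq> B2'"
          "atomic_type k B1' R' S' = atomic_type k B1 R S"
          "atomic_type k B2' R' S' = atomic_type k B2 R S" by auto
      have "c \<in> colour k S ` B1" using 4(4) uv(4) by blast
      then obtain u' where u': "u' \<in> B1'" "c = colour k S' u'"
        using B'(4) unfolding atomic_type_eq_iff by (metis imageE)
      have "c \<in> colour k S ` B2" using 4(5) uv(5) by blast
      then obtain v' where v': "v' \<in> B2'" "c = colour k S' v'"
        using B'(5) unfolding atomic_type_eq_iff by (metis imageE)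
      have "disjnt B1' B2'" using disj' B'(1-3) by (rule pairwiseD)
      then have "u' \<noteq> v'" using u'(1) v'(1) by (auto simp: disjnt_iff)
      moreover have "u' \<in> V'" "v' \<in> V'" using u'(1) v'(1) B'(1,2) V' by blast+
      ultimately show ?thesis using u'(2) v'(2) unfolding repeated_colours_def
        by (intro CollectI bexI[of _ u'] bexI[of _ v']) simp_all
    qed
  qed
qed

text \<open>The move \<open>A\<close> refines the colouring of the blocks of \<open>P\<close> from
  rank \<open>j + 1\<close> to rank \<open>j\<close>. \<open>recolour\<close> prescribes a type of
  rank \<open>j\<close> for every block of \<open>P'\<close>; it is attainable because a block of
  \<open>P\<close> with the same type of rank \<open>j + 1\<close> attains it. The local answers are
  then glued together.\<close>

lemma ty_star_extend:
  assumes G: "star V R r P" and G': "star V' R' r' P'"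
    and m: "matched (threshold k (Suc j)) P (\<lambda>B. ty k (Suc j) B R S) P' (\<lambda>B. ty k (Suc j) B R' S')"
  shows "\<exists>A'. (r \<in> A \<longleftrightarrow> r' \<in> A') \<and>
    matched (threshold k j) P (\<lambda>B. ty k j B R (S(j := A))) P' (\<lambda>B. ty k j B R' (S'(j := A')))"
proof -
  have fin: "finite P" "finite P'" and rP: "r' \<notin> \<Union>P'" and disj': "pairwise disjnt P'"
    using G G' unfolding star_def by blast+
  let ?f = "\<lambda>B. ty k j B R (S(j := A))"
  have "?f ` P \<subseteq> types k j" by (simp add: image_subset_iff ty_in_types)
  from recolour[OF fin finite_types this m[unfolded threshold.simps] threshold_pos]
  obtain g where g: "matched (threshold k j) P ?f P' g"
     "\<And>B'. B' \<in> P' \<Longrightarrow> \<exists>B\<in>P. ty k (Suc j) B R S = ty k (Suc j) B' R' S' \<and> ?f B = g B'"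
    by blast
  have "\<exists>A'. ty k j B' R' (S'(j := A')) = g B'" if "B' \<in> P'" for B'
  proof -
    obtain B where B: "ty k (Suc j) B R S = ty k (Suc j) B' R' S'" "?f B = g B'"
      using g(2)[OF \<open>B' \<in> P'\<close>] by blast
    obtain A' where "?f B = ty k j B' R' (S'(j := A'))" using ty_Suc_extend[OF B(1)] .
    then show ?thesis using B(2) by (intro exI[of _ A']) simp
  qed
  then obtain a where a: "\<And>B'. B' \<in> P' \<Longrightarrow> ty k j B' R' (S'(j := a B')) = g B'" by metis
  \<comment> \<open>Cutting each local answer down to its block keeps it from disturbing the others;
    the root is treated separately.\<close>
  define A' where "A' = (\<Union>B\<in>P'. a B \<inter> B) \<union> (if r \<in> A then {r'} else {})"
  have "ty k j B' R' (S'(j := A')) = g B'" if "B' \<in> P'" for B'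
  proof -
    have "v \<in> A' \<longleftrightarrow> v \<in> a B'" if "v \<in> B'" for v
    proof -
      have "B = B'" if "B \<in> P'" "v \<in> B" for B
        using disj' \<open>v \<in> B'\<close> \<open>B' \<in> P'\<close> that by (meson disjnt_iff pairwiseD)
      moreover have "v \<noteq> r'" using \<open>v \<in> B'\<close> \<open>B' \<in> P'\<close> rP by blast
      then have "v \<in> A' \<longleftrightarrow> (\<exists>B\<in>P'. v \<in> a B \<and> v \<in> B)" unfolding A'_def by simp
      ultimately show ?thesis using \<open>v \<in> B'\<close> \<open>B' \<in> P'\<close> by blast
    qed
    then have "ty k j B' R' (S'(j := A')) = ty k j B' R' (S'(j := a B'))"
      by (intro ty_iso[of id]) auto
    then show ?thesis using a that by simp
  qed
  then have "{B' \<in> P'. ty k j B' R' (S'(j := A')) = c} = {B' \<in> P'. g B' = c}" for c by auto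
  then have "matched (threshold k j) P ?f P' (\<lambda>B. ty k j B R' (S'(j := A')))"
    using g(1) by (simp add: matched_def)
  moreover have "r \<in> A \<longleftrightarrow> r' \<in> A'" using rP unfolding A'_def by auto
  ultimately show ?thesis by blast
qed

lemma ty_star:
  assumes G: "star V R r P" and G': "star V' R' r' P'" and "j \<le> k"
    and "\<And>v. v \<in> V \<Longrightarrow> v \<in> S k \<longleftrightarrow> (r, v) \<in> R" and "\<And>v. v \<in> V' \<Longrightarrow> v \<in> S' k \<longleftrightarrow> (r', v) \<in> R'"
    and "\<And>i. j \<le> i \<Longrightarrow> i \<le> k \<Longrightarrow> r \<in> S i \<longleftrightarrow> r' \<in> S' i"
    and "matched (threshold k j) P (\<lambda>B. ty k j B R S) P' (\<lambda>B. ty k j B R' S')"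
  shows "ty k j V R S = ty k j V' R' S'"
  using assms(3-)
proof (induction j arbitrary: S S')
  case 0
  have "colour k S r = colour k S' r'" using 0 by (simp add: colour_eq_iff)
  then show ?case
    using atomic_type_star_le[OF G G', of S k S'] atomic_type_star_le[OF G' G, of S' k S]
      matched_sym[OF 0(5)] 0 unfolding ty.simps(1) atomic_type_eq_iff by (simp add: subset_antisym)
next
  case (Suc j)
  have upd: "ty k j V R (S(j := A)) = ty k j V' R' (S'(j := A'))"
    if A: "r \<in> A \<longleftrightarrow> r' \<in> A'"
      and m: "matched (threshold k j) P (\<lambda>B. ty k j B R (S(j := A))) P' (\<lambda>B. ty k j B R' (S'(j := A')))"
    for A A'
  proof (intro Suc.IH m)
    show "j \<le> k" using Suc.prems(1) by simp
    show "r \<in> (S(j := A)) i \<longleftrightarrow> r' \<in> (S'(j := A')) i" if "j \<le> i" "i \<le> k" for i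
      using Suc.prems(4)[of i] A that by (cases "i = j") auto
  \<comment> \<open>The remaining goals concern the set with index \<open>k\<close>, which survives
    the update because \<open>j < k\<close>.\<close>
  qed (use Suc.prems(1-3) in auto)
  have 1: "\<exists>A'. ty k j V R (S(j := A)) = ty k j V' R' (S'(j := A'))" for A
    using ty_star_extend[OF G G' Suc.prems(5), of A] upd by blast
  have 2: "\<exists>A. ty k j V R (S(j := A)) = ty k j V' R' (S'(j := A'))" for A'
  proof -
    obtain A where A: "r' \<in> A' \<longleftrightarrow> r \<in> A" and m:
      "matched (threshold k j) P' (\<lambda>B. ty k j B R' (S'(j := A'))) P (\<lambda>B. ty k j B R (S(j := A)))"
      using ty_star_extend[OF G' G matched_sym[OF Suc.prems(5)], of A'] by blast
    show ?thesis using upd[OF A[symmetric] matched_sym[OF m]] by blast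
  qed
  show ?case unfolding ty_Suc_eq_iff
  proof (intro equalityI image_subsetI)
    show "ty k j V R (S(j := A)) \<in> range (\<lambda>A. ty k j V' R' (S'(j := A)))" for A
      using 1[of A] by blast
    show "ty k j V' R' (S'(j := A)) \<in> range (\<lambda>A. ty k j V R (S(j := A)))" for A
      using 2[of A] by (metis rangeI)
  qed
qed

subsection \<open>Types determine MSO sentences\<close>

lemma ty_atomic:
  assumes "ty k j V R S = ty k j V' R' S'"
  shows "\<exists>T T'. (\<forall>i\<ge>j. T i = S i \<and> T' i = S' i) \<and> atomic_type k V R T = atomic_type k V' R' T'"
  using assms
proof (induction j arbitrary: S S')
  case 0
  then show ?case by auto
next
  case (Suc j)
  obtain A where "ty k j V R (S(j := {})) = ty k j V' R' (S'(j := A))"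
    using ty_Suc_extend[OF Suc.prems] .
  from Suc.IH[OF this] obtain T T' where
    "\<forall>i\<ge>j. T i = (S(j := {})) i \<and> T' i = (S'(j := A)) i"
    "atomic_type k V R T = atomic_type k V' R' T'" by blast
  moreover from this(1) have "\<forall>i\<ge>Suc j. T i = S i \<and> T' i = S' i" by auto
  ultimately show ?case by blast
qed

text \<open>This lemma and the next two express a property of the sets purely by components of the
  atomic type, so that equality of atomic types transfers it.\<close>

lemma meets_iff_colour:
  assumes "a \<le> k" "b \<le> k"
  shows "(\<exists>v\<in>V. v \<in> S a \<and> v \<in> S b) \<longleftrightarrow> (\<exists>c\<in>colour k S ` V. a \<in> set_decode c \<and> b \<in> set_decode c)"
  using assms by (auto simp: in_colour)

lemma arc_iff_arc_colour:
  assumes "a \<le> k" "b \<le> k"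
  shows "(\<exists>u\<in>V. \<exists>v\<in>V. (u, v) \<in> R \<and> u \<in> S a \<and> v \<in> S b) \<longleftrightarrow>
     (\<exists>c\<in>arc_colours k V R S. a \<in> set_decode (fst (prod_decode c)) \<and> b \<in> set_decode (snd (prod_decode c)))"
proof
  assume "\<exists>u\<in>V. \<exists>v\<in>V. (u, v) \<in> R \<and> u \<in> S a \<and> v \<in> S b"
  then obtain u v where "u \<in> V" "v \<in> V" "(u, v) \<in> R" "u \<in> S a" "v \<in> S b" by blast
  then show "\<exists>c\<in>arc_colours k V R S. a \<in> set_decode (fst (prod_decode c)) \<and> b \<in> set_decode (snd (prod_decode c))"
    using assms unfolding arc_colours_def
    by (intro bexI[of _ "prod_encode (colour k S u, colour k S v)"]) (auto simp: in_colour)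
qed (use assms in \<open>fastforce simp: arc_colours_def in_colour\<close>)

text \<open>Exactly one element means one colour containing \<open>a\<close>, carried by one vertex
  only; the latter is what \<open>repeated_colours\<close> can tell.\<close>

lemma singleton_iff_colour:
  assumes "a \<le> k"
  shows "(\<exists>v. S a \<inter> V = {v}) \<longleftrightarrow> (\<exists>c\<in>colour k S ` V. a \<in> set_decode c \<and>
     c \<notin> repeated_colours k V S \<and> (\<forall>d\<in>colour k S ` V. a \<in> set_decode d \<longrightarrow> d = c))" (is "?L \<longleftrightarrow> ?R")
proof
  assume ?L
  then obtain v where v: "S a \<inter> V = {v}" by blast
  then have "v \<in> V" by blast
  have a: "a \<in> set_decode (colour k S u) \<longleftrightarrow> u = v" if "u \<in> V" for u
    using v that assms by (auto simp: in_colour)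
  have "u = v" if "u \<in> V" "colour k S u = colour k S v" for u
    using a[of u] a[of v] that \<open>v \<in> V\<close> by simp
  then have "colour k S v \<notin> repeated_colours k V S"
    unfolding repeated_colours_def by blast
  then show ?R using a \<open>v \<in> V\<close> by (intro bexI[of _ "colour k S v"]) auto
next
  assume ?R
  then obtain v where v: "v \<in> V" "a \<in> set_decode (colour k S v)"
    "colour k S v \<notin> repeated_colours k V S"
    "\<forall>d\<in>colour k S ` V. a \<in> set_decode d \<longrightarrow> d = colour k S v" by blast
  have "u = v" if "u \<in> V" "u \<in> S a" for u
  proof -
    have "colour k S u = colour k S v" using v(4) that assms by (simp add: in_colour)
    then show ?thesis using that(1) v(1,3) unfolding repeated_colours_def by blast
  qed
  moreover have "v \<in> S a" using v(2) by (simp add: in_colour)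
  ultimately have "S a \<inter> V = {v}" using v(1) by blast
  then show ?L by blast
qed

lemma ty_eq_imp:
  assumes "ty k j V R S = ty k j V' R' S'" "j \<le> a" "a \<le> k" "j \<le> b" "b \<le> k"
  shows "(\<exists>v\<in>V. v \<in> S a \<and> v \<in> S b) \<longleftrightarrow> (\<exists>v\<in>V'. v \<in> S' a \<and> v \<in> S' b)"
    "(\<exists>u\<in>V. \<exists>v\<in>V. (u, v) \<in> R \<and> u \<in> S a \<and> v \<in> S b) \<longleftrightarrow>
     (\<exists>u\<in>V'. \<exists>v\<in>V'. (u, v) \<in> R' \<and> u \<in> S' a \<and> v \<in> S' b)"
    "(\<exists>v. S a \<inter> V = {v}) \<longleftrightarrow> (\<exists>v. S' a \<inter> V' = {v})"
proof -
  obtain T T' where T: "\<forall>i\<ge>j. T i = S i \<and> T' i = S' i" and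
    at: "atomic_type k V R T = atomic_type k V' R' T'"
    using ty_atomic[OF assms(1)] by blast
  have eqs: "S a = T a" "S b = T b" "S' a = T' a" "S' b = T' b" using T assms by simp_all
  note at' = at[unfolded atomic_type_eq_iff]
  show "(\<exists>v\<in>V. v \<in> S a \<and> v \<in> S b) \<longleftrightarrow> (\<exists>v\<in>V'. v \<in> S' a \<and> v \<in> S' b)"
    unfolding eqs meets_iff_colour[OF assms(3,5)] using at' by simp
  show "(\<exists>u\<in>V. \<exists>v\<in>V. (u, v) \<in> R \<and> u \<in> S a \<and> v \<in> S b) \<longleftrightarrow>
     (\<exists>u\<in>V'. \<exists>v\<in>V'. (u, v) \<in> R' \<and> u \<in> S' a \<and> v \<in> S' b)"
    unfolding eqs arc_iff_arc_colour[OF assms(3,5)] using at' by simp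
  show "(\<exists>v. S a \<inter> V = {v}) \<longleftrightarrow> (\<exists>v. S' a \<inter> V' = {v})"
    unfolding eqs singleton_iff_colour[OF assms(3)] using at' by simp
qed

lemma Int_singletonD:
  assumes "A \<inter> V = {a}"
  shows "a \<in> V" "a \<in> A" "\<And>v. v \<in> V \<Longrightarrow> v \<in> A \<Longrightarrow> v = a"
proof -
  have *: "v \<in> A \<and> v \<in> V \<longleftrightarrow> v = a" for v using assms by (simp add: set_eq_iff)
  show "a \<in> V" "a \<in> A" using *[of a] by simp_all
  show "v = a" if "v \<in> V" "v \<in> A" for v using *[of v] that by simp
qed

lemma meets_singletons:
  assumes "A \<inter> V = {a}" "B \<inter> V = {b}"
  shows "(\<exists>v\<in>V. v \<in> A \<and> v \<in> B) \<longleftrightarrow> a = b"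
proof
  assume "\<exists>v\<in>V. v \<in> A \<and> v \<in> B"
  then obtain v where v: "v \<in> V" "v \<in> A" "v \<in> B" by blast
  show "a = b" using Int_singletonD(3)[OF assms(1) v(1,2)] Int_singletonD(3)[OF assms(2) v(1,3)] by simp
next
  assume "a = b"
  then show "\<exists>v\<in>V. v \<in> A \<and> v \<in> B"
    using Int_singletonD(1,2)[OF assms(1)] Int_singletonD(1,2)[OF assms(2)] by (intro bexI[of _ a]) simp_all
qed

lemma arc_singletons:
  assumes "A \<inter> V = {a}" "B \<inter> V = {b}"
  shows "(\<exists>u\<in>V. \<exists>v\<in>V. (u, v) \<in> R \<and> u \<in> A \<and> v \<in> B) \<longleftrightarrow> (a, b) \<in> R"
proof
  assume "\<exists>u\<in>V. \<exists>v\<in>V. (u, v) \<in> R \<and> u \<in> A \<and> v \<in> B"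
  then obtain u v where v: "u \<in> V" "v \<in> V" "(u, v) \<in> R" "u \<in> A" "v \<in> B" by blast
  show "(a, b) \<in> R"
    using v(3) Int_singletonD(3)[OF assms(1) v(1,4)] Int_singletonD(3)[OF assms(2) v(2,5)] by simp
next
  assume "(a, b) \<in> R"
  then show "\<exists>u\<in>V. \<exists>v\<in>V. (u, v) \<in> R \<and> u \<in> A \<and> v \<in> B"
    using Int_singletonD(1,2)[OF assms(1)] Int_singletonD(1,2)[OF assms(2)] by blast
qed

lemma meets_singleton_set:
  assumes "A \<inter> V = {a}" "B \<inter> V = T \<inter> V"
  shows "(\<exists>v\<in>V. v \<in> A \<and> v \<in> B) \<longleftrightarrow> a \<in> T"
proof -
  have "v \<in> B \<longleftrightarrow> v \<in> T" if "v \<in> V" for v using assms(2) that by (auto simp: set_eq_iff)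
  moreover have "(\<exists>v\<in>V. v \<in> A \<and> v \<in> B) \<longleftrightarrow> a \<in> B"
    using Int_singletonD[OF assms(1)] by blast
  ultimately show ?thesis using Int_singletonD(1)[OF assms(1)] by simp
qed

text \<open>\<open>\<rho>\<close> and \<open>\<sigma>\<close> give for each variable the index of
  the game set that holds its value. A quantifier plays the set with index \<open>j - 1\<close> and
  redirects its variable there, so a variable may be bound repeatedly.\<close>

lemma ty_sat:
  fixes s :: "nat \<Rightarrow> 'a" and s' :: "nat \<Rightarrow> 'b"
  assumes "ty k j (pverts G) (parcs G) S = ty k j (pverts G') (parcs G') S'"
    and "quantifier_depth \<phi> \<le> j" "j \<le> k"
    and "\<forall>x\<in>free_vertex_vars \<phi>. j \<le> \<rho> x \<and> \<rho> x \<le> k \<and>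
       S (\<rho> x) \<inter> pverts G = {s x} \<and> S' (\<rho> x) \<inter> pverts G' = {s' x}"
    and "\<forall>X\<in>free_set_vars \<phi>. j \<le> \<sigma> X \<and> \<sigma> X \<le> k \<and>
       S (\<sigma> X) \<inter> pverts G = T X \<inter> pverts G \<and> S' (\<sigma> X) \<inter> pverts G' = T' X \<inter> pverts G'"
  shows "sat G s T \<phi> \<longleftrightarrow> sat G' s' T' \<phi>"
  using assms
proof (induction \<phi> arbitrary: j S S' s s' T T' \<rho> \<sigma>)
  case (Eq x y)
  have x: "j \<le> \<rho> x" "\<rho> x \<le> k" "S (\<rho> x) \<inter> pverts G = {s x}" "S' (\<rho> x) \<inter> pverts G' = {s' x}"
    using bspec[OF Eq.prems(4), of x] by simp_all
  have y: "j \<le> \<rho> y" "\<rho> y \<le> k" "S (\<rho> y) \<inter> pverts G = {s y}" "S' (\<rho> y) \<inter> pverts G' = {s' y}"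
    using bspec[OF Eq.prems(4), of y] by simp_all
  have "s x = s y \<longleftrightarrow> (\<exists>v\<in>pverts G. v \<in> S (\<rho> x) \<and> v \<in> S (\<rho> y))" by (rule meets_singletons[OF x(3) y(3), symmetric])
  also have "\<dots> \<longleftrightarrow> (\<exists>v\<in>pverts G'. v \<in> S' (\<rho> x) \<and> v \<in> S' (\<rho> y))"
    by (rule ty_eq_imp(1)[OF Eq.prems(1) x(1,2) y(1,2)])
  also have "\<dots> \<longleftrightarrow> s' x = s' y" by (rule meets_singletons[OF x(4) y(4)])
  finally show ?case by simp
next
  case (Adj x y)
  have x: "j \<le> \<rho> x" "\<rho> x \<le> k" "S (\<rho> x) \<inter> pverts G = {s x}" "S' (\<rho> x) \<inter> pverts G' = {s' x}"
    using bspec[OF Adj.prems(4), of x] by simp_all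
  have y: "j \<le> \<rho> y" "\<rho> y \<le> k" "S (\<rho> y) \<inter> pverts G = {s y}" "S' (\<rho> y) \<inter> pverts G' = {s' y}"
    using bspec[OF Adj.prems(4), of y] by simp_all
  have "(s x, s y) \<in> parcs G \<longleftrightarrow>
      (\<exists>u\<in>pverts G. \<exists>v\<in>pverts G. (u, v) \<in> parcs G \<and> u \<in> S (\<rho> x) \<and> v \<in> S (\<rho> y))"
    by (rule arc_singletons[OF x(3) y(3), symmetric])
  also have "\<dots> \<longleftrightarrow> (\<exists>u\<in>pverts G'. \<exists>v\<in>pverts G'. (u, v) \<in> parcs G' \<and> u \<in> S' (\<rho> x) \<and> v \<in> S' (\<rho> y))"
    by (rule ty_eq_imp(2)[OF Adj.prems(1) x(1,2) y(1,2)])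
  also have "\<dots> \<longleftrightarrow> (s' x, s' y) \<in> parcs G'" by (rule arc_singletons[OF x(4) y(4)])
  finally show ?case by simp
next
  case (Mem x X)
  have x: "j \<le> \<rho> x" "\<rho> x \<le> k" "S (\<rho> x) \<inter> pverts G = {s x}" "S' (\<rho> x) \<inter> pverts G' = {s' x}"
    using bspec[OF Mem.prems(4), of x] by simp_all
  have X: "j \<le> \<sigma> X" "\<sigma> X \<le> k" "S (\<sigma> X) \<inter> pverts G = T X \<inter> pverts G"
      "S' (\<sigma> X) \<inter> pverts G' = T' X \<inter> pverts G'"
    using bspec[OF Mem.prems(5), of X] by simp_all
  have "s x \<in> T X \<longleftrightarrow> (\<exists>v\<in>pverts G. v \<in> S (\<rho> x) \<and> v \<in> S (\<sigma> X))" by (rule meets_singleton_set[OF x(3) X(3), symmetric])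
  also have "\<dots> \<longleftrightarrow> (\<exists>v\<in>pverts G'. v \<in> S' (\<rho> x) \<and> v \<in> S' (\<sigma> X))"
    by (rule ty_eq_imp(1)[OF Mem.prems(1) x(1,2) X(1,2)])
  also have "\<dots> \<longleftrightarrow> s' x \<in> T' X" by (rule meets_singleton_set[OF x(4) X(4)])
  finally show ?case by simp
next
  case (Neg \<phi>)
  have "sat G s T \<phi> \<longleftrightarrow> sat G' s' T' \<phi>"
    by (rule Neg.IH[OF Neg.prems(1), where \<rho> = \<rho> and \<sigma> = \<sigma>]) (use Neg.prems(2-) in simp_all)
  then show ?case by simp
next
  case (Conj \<phi> \<psi>)
  have "sat G s T \<phi> \<longleftrightarrow> sat G' s' T' \<phi>"
    by (rule Conj.IH(1)[OF Conj.prems(1), where \<rho> = \<rho> and \<sigma> = \<sigma>]) (use Conj.prems(2-) in \<open>simp_all add: ball_Un\<close>)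
  moreover have "sat G s T \<psi> \<longleftrightarrow> sat G' s' T' \<psi>"
    by (rule Conj.IH(2)[OF Conj.prems(1), where \<rho> = \<rho> and \<sigma> = \<sigma>]) (use Conj.prems(2-) in \<open>simp_all add: ball_Un\<close>)
  ultimately show ?case by simp
next
  case (Ex_vertex x \<phi>)
  then obtain i where j: "j = Suc i" by (cases j) auto
  note ty = Ex_vertex.prems(1)[unfolded j]
  have step: "sat G (s(x := v)) T \<phi> \<longleftrightarrow> sat G' (s'(x := v')) T' \<phi>"
    if "ty k i (pverts G) (parcs G) (S(i := A)) = ty k i (pverts G') (parcs G') (S'(i := A'))"
      "A \<inter> pverts G = {v}" "A' \<inter> pverts G' = {v'}" for A A' v v'
  proof (rule Ex_vertex.IH[OF that(1), where \<rho> = "\<rho>(x := i)" and \<sigma> = \<sigma>])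
    show "quantifier_depth \<phi> \<le> i" "i \<le> k" using Ex_vertex.prems(2,3) j by simp_all
    show "\<forall>y\<in>free_vertex_vars \<phi>. i \<le> (\<rho>(x := i)) y \<and> (\<rho>(x := i)) y \<le> k \<and>
       (S(i := A)) ((\<rho>(x := i)) y) \<inter> pverts G = {(s(x := v)) y} \<and>
       (S'(i := A')) ((\<rho>(x := i)) y) \<inter> pverts G' = {(s'(x := v')) y}"
    proof
      fix y assume "y \<in> free_vertex_vars \<phi>"
      then show "i \<le> (\<rho>(x := i)) y \<and> (\<rho>(x := i)) y \<le> k \<and>
         (S(i := A)) ((\<rho>(x := i)) y) \<inter> pverts G = {(s(x := v)) y} \<and>
         (S'(i := A')) ((\<rho>(x := i)) y) \<inter> pverts G' = {(s'(x := v')) y}"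
        using that(2,3) \<open>i \<le> k\<close> bspec[OF Ex_vertex.prems(4), of y] by (cases "y = x") (simp_all add: j)
    qed
    show "\<forall>X\<in>free_set_vars \<phi>. i \<le> \<sigma> X \<and> \<sigma> X \<le> k \<and>
       (S(i := A)) (\<sigma> X) \<inter> pverts G = T X \<inter> pverts G \<and>
       (S'(i := A')) (\<sigma> X) \<inter> pverts G' = T' X \<inter> pverts G'"
    proof
      fix X assume "X \<in> free_set_vars \<phi>"
      then show "i \<le> \<sigma> X \<and> \<sigma> X \<le> k \<and> (S(i := A)) (\<sigma> X) \<inter> pverts G = T X \<inter> pverts G \<and>
         (S'(i := A')) (\<sigma> X) \<inter> pverts G' = T' X \<inter> pverts G'"
        using bspec[OF Ex_vertex.prems(5), of X] by (simp add: j)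
    qed
  qed
  \<comment> \<open>Types recognise singletons, so a vertex is answered by a vertex.\<close>
  have single: "(\<exists>v. A \<inter> pverts G = {v}) \<longleftrightarrow> (\<exists>v. A' \<inter> pverts G' = {v})"
    if "ty k i (pverts G) (parcs G) (S(i := A)) = ty k i (pverts G') (parcs G') (S'(i := A'))" for A A'
    using ty_eq_imp(3)[OF that, of i i] Ex_vertex.prems(3) by (simp add: j)
  show ?case
  proof
    assume "sat G s T (Ex_vertex x \<phi>)"
    then obtain v where v: "v \<in> pverts G" "sat G (s(x := v)) T \<phi>" by auto
    obtain A' where A': "ty k i (pverts G) (parcs G) (S(i := {v})) =
        ty k i (pverts G') (parcs G') (S'(i := A'))"
      using ty_Suc_extend[OF ty] .
    obtain v' where "A' \<inter> pverts G' = {v'}" using single[OF A'] v(1) by auto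
    moreover from this have "v' \<in> pverts G'" by (rule Int_singletonD)
    ultimately show "sat G' s' T' (Ex_vertex x \<phi>)" using step[OF A', of v v'] v by auto
  next
    assume "sat G' s' T' (Ex_vertex x \<phi>)"
    then obtain v' where v': "v' \<in> pverts G'" "sat G' (s'(x := v')) T' \<phi>" by auto
    obtain A where "ty k i (pverts G') (parcs G') (S'(i := {v'})) =
        ty k i (pverts G) (parcs G) (S(i := A))"
      using ty_Suc_extend[OF ty[symmetric]] .
    note A = this[symmetric]
    obtain v where "A \<inter> pverts G = {v}" using single[OF A] v'(1) by auto
    moreover from this have "v \<in> pverts G" by (rule Int_singletonD)
    ultimately show "sat G s T (Ex_vertex x \<phi>)" using step[OF A, of v v'] v' by auto
  qed
next
  case (Ex_set X \<phi>)
  then obtain i where j: "j = Suc i" by (cases j) auto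
  note ty = Ex_set.prems(1)[unfolded j]
  \<comment> \<open>Game sets may leave the graph, whereas MSO set variables range over sets of its
    vertices; hence the intersections.\<close>
  have step: "sat G s (T(X := A \<inter> pverts G)) \<phi> \<longleftrightarrow> sat G' s' (T'(X := A' \<inter> pverts G')) \<phi>"
    if "ty k i (pverts G) (parcs G) (S(i := A)) = ty k i (pverts G') (parcs G') (S'(i := A'))" for A A'
  proof (rule Ex_set.IH[OF that, where \<rho> = \<rho> and \<sigma> = "\<sigma>(X := i)"])
    show "quantifier_depth \<phi> \<le> i" "i \<le> k" using Ex_set.prems(2,3) j by simp_all
    show "\<forall>x\<in>free_vertex_vars \<phi>. i \<le> \<rho> x \<and> \<rho> x \<le> k \<and>
       (S(i := A)) (\<rho> x) \<inter> pverts G = {s x} \<and> (S'(i := A')) (\<rho> x) \<inter> pverts G' = {s' x}"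
    proof
      fix x assume "x \<in> free_vertex_vars \<phi>"
      then show "i \<le> \<rho> x \<and> \<rho> x \<le> k \<and>
         (S(i := A)) (\<rho> x) \<inter> pverts G = {s x} \<and> (S'(i := A')) (\<rho> x) \<inter> pverts G' = {s' x}"
        using bspec[OF Ex_set.prems(4), of x] by (simp add: j)
    qed
    show "\<forall>Y\<in>free_set_vars \<phi>. i \<le> (\<sigma>(X := i)) Y \<and> (\<sigma>(X := i)) Y \<le> k \<and>
       (S(i := A)) ((\<sigma>(X := i)) Y) \<inter> pverts G = (T(X := A \<inter> pverts G)) Y \<inter> pverts G \<and>
       (S'(i := A')) ((\<sigma>(X := i)) Y) \<inter> pverts G' = (T'(X := A' \<inter> pverts G')) Y \<inter> pverts G'"
    proof
      fix Y assume "Y \<in> free_set_vars \<phi>"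
      then show "i \<le> (\<sigma>(X := i)) Y \<and> (\<sigma>(X := i)) Y \<le> k \<and>
         (S(i := A)) ((\<sigma>(X := i)) Y) \<inter> pverts G = (T(X := A \<inter> pverts G)) Y \<inter> pverts G \<and>
         (S'(i := A')) ((\<sigma>(X := i)) Y) \<inter> pverts G' = (T'(X := A' \<inter> pverts G')) Y \<inter> pverts G'"
        using \<open>i \<le> k\<close> bspec[OF Ex_set.prems(5), of Y] by (cases "Y = X") (simp_all add: j)
    qed
  qed
  show ?case
  proof
    assume "sat G s T (Ex_set X \<phi>)"
    then obtain A where A: "A \<subseteq> pverts G" "sat G s (T(X := A)) \<phi>" by auto
    obtain A' where "ty k i (pverts G) (parcs G) (S(i := A)) =
        ty k i (pverts G') (parcs G') (S'(i := A'))"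
      using ty_Suc_extend[OF ty] .
    then have "sat G' s' (T'(X := A' \<inter> pverts G')) \<phi>"
      using step A by (metis Int_absorb2)
    then show "sat G' s' T' (Ex_set X \<phi>)" by auto
  next
    assume "sat G' s' T' (Ex_set X \<phi>)"
    then obtain A' where A': "A' \<subseteq> pverts G'" "sat G' s' (T'(X := A')) \<phi>" by auto
    obtain A where "ty k i (pverts G') (parcs G') (S'(i := A')) =
        ty k i (pverts G) (parcs G) (S(i := A))"
      using ty_Suc_extend[OF ty[symmetric]] .
    then have "sat G s (T(X := A \<inter> pverts G)) \<phi>"
      using step A' by (metis Int_absorb2)
    then show "sat G s T (Ex_set X \<phi>)" by auto
  qed
qed

text \<open>The assignments are arbitrary: agreement on richer structures implies agreement on the
  bare graphs. The application puts the neighbourhoods of the roots there.\<close>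

lemma ty_eq_imp_mso_equiv:
  assumes "ty k k (pverts G) (parcs G) S = ty k k (pverts G') (parcs G') S'"
  shows "mso_equiv k G G'"
  unfolding mso_equiv_def holds_in_def
proof (intro allI impI)
  fix \<phi> assume "sentence \<phi> \<and> quantifier_depth \<phi> \<le> k"
  then show "sat G (\<lambda>_. undefined) (\<lambda>_. {}) \<phi> \<longleftrightarrow> sat G' (\<lambda>_. undefined) (\<lambda>_. {}) \<phi>"
    by (intro ty_sat[OF assms, where \<rho> = id and \<sigma> = id]) (simp_all add: sentence_def)
qed

subsection \<open>Graphs, components and minors\<close>

lemma pair_graph_arcsD:
  assumes "pair_graph G" "(u, v) \<in> parcs G"
  shows "u \<in> pverts G" "v \<in> pverts G" "u \<noteq> v" "(v, u) \<in> parcs G"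
proof -
  interpret pair_graph G by fact
  show "u \<in> pverts G" "v \<in> pverts G" "(v, u) \<in> parcs G"
    using assms(2) in_arcsD1 in_arcsD2 arcs_symmetric by blast+
  show "u \<noteq> v" using pair_no_loops[OF assms(2)] by simp
qed

lemma pair_graph_irrefl: "pair_graph G \<Longrightarrow> (v, v) \<notin> parcs G"
  using pair_graph_arcsD(3)[of G v v] by auto

lemma pair_graph_finite: "pair_graph G \<Longrightarrow> finite (pverts G)"
  by (simp add: pair_graph_def pair_digraph_def pair_fin_digraph.pair_finite_verts)

lemma pair_graphI:
  assumes "finite (pverts G)"
    and "\<And>u v. (u, v) \<in> parcs G \<Longrightarrow> u \<in> pverts G \<and> v \<in> pverts G \<and> u \<noteq> v \<and> (v, u) \<in> parcs G"
  shows "pair_graph G"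
proof unfold_locales
  have "parcs G \<subseteq> pverts G \<times> pverts G" using assms(2) by auto
  then show "finite (parcs G)" using assms(1) by (meson finite_SigmaI finite_subset)
  show "symmetric (with_proj G)"
    unfolding symmetric_def with_proj_simps using assms(2) by (intro symI) blast
  show "finite (pverts G)" by fact
  show "fst e \<in> pverts G" "snd e \<in> pverts G" "fst e \<noteq> snd e" if "e \<in> parcs G" for e
    using assms(2)[of "fst e" "snd e"] that by simp_all
qed

lemma sym_parcs: "pair_graph G \<Longrightarrow> sym (parcs G)"
  by (rule symI) (rule pair_graph_arcsD(4))

lemma reachable_iff_rtrancl:
  assumes "pair_graph G" "u \<in> pverts G"
  shows "reachable (with_proj G) u v \<longleftrightarrow> (u, v) \<in> (parcs G)\<^sup>*"
proof -
  interpret pair_graph G by fact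
  show ?thesis using reachable_conv'[of u v] assms(2) by simp
qed

lemma connected_iff_rtrancl:
  assumes "pair_graph G"
  shows "connected (with_proj G) \<longleftrightarrow>
     pverts G \<noteq> {} \<and> (\<forall>u\<in>pverts G. \<forall>v\<in>pverts G. (u, v) \<in> (parcs G)\<^sup>*)"
proof -
  have "symcl (parcs G) = parcs G"
    using pair_graph_arcsD(4)[OF assms] by (auto simp: symcl_def)
  then show ?thesis
    using reachable_iff_rtrancl[OF assms]
    by (simp add: connected_conv reachable_def)
qed

lemma connectedI_root:
  assumes G: "pair_graph G" and r: "r \<in> pverts G" and reach: "\<And>v. v \<in> pverts G \<Longrightarrow> (r, v) \<in> (parcs G)\<^sup>*"
  shows "connected (with_proj G)"
proof -
  have "(u, v) \<in> (parcs G)\<^sup>*" if "u \<in> pverts G" "v \<in> pverts G" for u v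
  proof -
    have "(u, r) \<in> (parcs G)\<^sup>*"
      using reach[OF that(1)] sym_rtrancl[OF sym_parcs[OF G]] by (meson symD)
    then show ?thesis using reach[OF that(2)] by (rule rtrancl_trans)
  qed
  then show ?thesis unfolding connected_iff_rtrancl[OF G] using r by blast
qed

section \<open>Induced subgraphs and components\<close>

definition induced :: "'a pair_pre_digraph \<Rightarrow> 'a set \<Rightarrow> 'a pair_pre_digraph" where
  "induced G S = \<lparr> pverts = S, parcs = {(x, y) \<in> parcs G. x \<in> S \<and> y \<in> S} \<rparr>"

lemma induced_simps [simp]:
  "pverts (induced G S) = S"
  "(x, y) \<in> parcs (induced G S) \<longleftrightarrow> (x, y) \<in> parcs G \<and> x \<in> S \<and> y \<in> S"
  by (auto simp: induced_def)

lemma pair_pre_digraph_eqI: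
  fixes G H :: "'a pair_pre_digraph"
  assumes "pverts G = pverts H" "\<And>x y. (x, y) \<in> parcs G \<longleftrightarrow> (x, y) \<in> parcs H"
  shows "G = H"
proof (rule pair_pre_digraph.equality)
  show "parcs G = parcs H" using assms(2) by (simp add: set_eq_iff split_paired_all)
qed (use assms(1) in simp_all)

lemma pair_graph_induced:
  assumes "pair_graph G" "S \<subseteq> pverts G"
  shows "pair_graph (induced G S)"
proof (rule pair_graphI)
  show "finite (pverts (induced G S))"
    using assms pair_graph_finite finite_subset by (auto simp: induced_def)
  fix u v assume "(u, v) \<in> parcs (induced G S)"
  then show "u \<in> pverts (induced G S) \<and> v \<in> pverts (induced G S) \<and> u \<noteq> v \<and>
      (v, u) \<in> parcs (induced G S)"
    using pair_graph_arcsD[OF assms(1), of u v] by simp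
qed

lemma minor_induced:
  assumes G: "pair_graph G" and "S \<subseteq> pverts G"
  shows "minor (induced G S) G"
proof -
  have "minor (induced G (pverts G - D)) G" if "finite D" "D \<subseteq> pverts G" for D
    using that
  proof (induction D rule: finite_induct)
    case empty
    have "induced G (pverts G - {}) = G"
      using pair_graph_arcsD(1,2)[OF G] by (intro pair_pre_digraph_eqI) auto
    then show ?case using minor_refl by simp
  next
    case (insert d D)
    have "delete_vertex (induced G (pverts G - D)) d = induced G (pverts G - insert d D)"
      by (intro pair_pre_digraph_eqI) (auto simp: delete_vertex_def)
    moreover have "minor (delete_vertex (induced G (pverts G - D)) d) G"
      using insert by (intro minor_delete_vertex) auto
    ultimately show ?case by simp
  qed
  from this[of "pverts G - S"] show ?thesis
    using assms(2) pair_graph_finite[OF G] by (simp add: double_diff)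
qed

text \<open>Arcs go both ways, so mutual reachability is plain reachability, and the strongly
  connected components become its classes.\<close>

lemma components_eq_image:
  assumes G: "pair_graph G"
  shows "components G = (\<lambda>u. induced G {v. (u, v) \<in> (parcs G)\<^sup>*}) ` pverts G"
proof -
  interpret pair_graph G by fact
  have scc: "scc_of u = {v. (u, v) \<in> (parcs G)\<^sup>*}" if "u \<in> pverts G" for u
    using reachable_iff_rtrancl[OF G that] symmetric_reachable' unfolding scc_of_def by blast
  have ind: "with_proj H = with_proj G \<restriction> S \<longleftrightarrow> H = induced G S" for H S
  proof -
    have "with_proj G \<restriction> S = with_proj (induced G S)"
      by (auto simp: with_proj_def induce_subgraph_def induced_def)
    moreover have "with_proj H = with_proj (induced G S) \<Longrightarrow> H = induced G S"
      by (rule pair_pre_digraph.equality) (simp_all add: with_proj_def)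
    ultimately show ?thesis by auto
  qed
  have "H \<in> components G \<longleftrightarrow> (\<exists>u\<in>pverts G. H = induced G (scc_of u))" for H
    unfolding components_def sccs_conv_sccs_verts sccs_verts_conv_scc_of
    by (simp add: image_iff ind)
  then show ?thesis using scc by (auto simp: image_iff)
qed

section \<open>Disjoint unions\<close>

definition disjoint_union :: "'a pair_pre_digraph \<Rightarrow> 'a pair_pre_digraph \<Rightarrow> 'a pair_pre_digraph" where
  "disjoint_union G H = \<lparr> pverts = pverts G \<union> pverts H, parcs = parcs G \<union> parcs H \<rparr>"

lemma disjoint_union_simps [simp]:
  "pverts (disjoint_union G H) = pverts G \<union> pverts H"
  "parcs (disjoint_union G H) = parcs G \<union> parcs H"
  by (simp_all add: disjoint_union_def)

lemma pair_graph_disjoint_union: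
  assumes "pair_graph G" "pair_graph H"
  shows "pair_graph (disjoint_union G H)"
proof (rule pair_graphI)
  show "finite (pverts (disjoint_union G H))" 
    using pair_graph_finite[OF assms(1)] pair_graph_finite[OF assms(2)] by simp
  fix u v assume "(u, v) \<in> parcs (disjoint_union G H)"
  then have "(u, v) \<in> parcs G \<or> (u, v) \<in> parcs H" by simp
  then show "u \<in> pverts (disjoint_union G H) \<and> v \<in> pverts (disjoint_union G H) \<and> u \<noteq> v \<and>
      (v, u) \<in> parcs (disjoint_union G H)"
    using pair_graph_arcsD[OF assms(1), of u v] pair_graph_arcsD[OF assms(2), of u v] by auto
qed

text \<open>No walk from \<open>G\<close> can enter \<open>H\<close>, since each arc of the union
  stays within one of the two.\<close>

lemma component_disjoint_union:
  assumes G: "pair_graph G" and H: "pair_graph H" and conn: "connected (with_proj G)"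
    and disj: "pverts G \<inter> pverts H = {}" and u: "u \<in> pverts G"
  shows "induced (disjoint_union G H) {v. (u, v) \<in> (parcs G \<union> parcs H)\<^sup>*} = G"
proof -
  have "v \<in> pverts G" if "(u, v) \<in> (parcs G \<union> parcs H)\<^sup>*" for v
    using that
  proof induction
    case (step y z)
    then have "(y, z) \<in> parcs G" using disj pair_graph_arcsD(1)[OF H] by blast
    then show ?case by (rule pair_graph_arcsD(2)[OF G])
  qed (rule u)
  moreover have "(u, v) \<in> (parcs G \<union> parcs H)\<^sup>*" if "v \<in> pverts G" for v
  proof -
    have "(u, v) \<in> (parcs G)\<^sup>*" using conn u that unfolding connected_iff_rtrancl[OF G] by blast
    then show ?thesis by (rule subsetD[OF rtrancl_mono, rotated]) blast
  qed
  ultimately have V: "{v. (u, v) \<in> (parcs G \<union> parcs H)\<^sup>*} = pverts G" by blast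
  show ?thesis unfolding V
  proof (rule pair_pre_digraph_eqI)
    fix x y
    have "(x, y) \<notin> parcs H" if "x \<in> pverts G"
      using that pair_graph_arcsD(1)[OF H] disj by blast
    then show "(x, y) \<in> parcs (induced (disjoint_union G H) (pverts G)) \<longleftrightarrow> (x, y) \<in> parcs G"
      using pair_graph_arcsD(1,2)[OF G] by auto
  qed simp
qed

text \<open>Lets \<open>decomposable\<close> put a disjoint union into the class; the edge clause of
  \<open>addable\<close> then applies to the two parts as distinct components.\<close>

lemma components_disjoint_union:
  assumes G: "pair_graph G" and H: "pair_graph H" 
    and conn: "connected (with_proj G)" "connected (with_proj H)"
    and disj: "pverts G \<inter> pverts H = {}"
  shows "components (disjoint_union G H) = {G, H}"
proof -
  let ?c = "\<lambda>u. induced (disjoint_union G H) {v. (u, v) \<in> (parcs G \<union> parcs H)\<^sup>*}"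
  have "?c u = G" if "u \<in> pverts G" for u
    by (rule component_disjoint_union[OF G H conn(1) disj that])
  moreover have "?c u = H" if "u \<in> pverts H" for u
  proof -
    have "disjoint_union G H = disjoint_union H G" "parcs G \<union> parcs H = parcs H \<union> parcs G"
      by (auto simp: disjoint_union_def)
    moreover have "pverts H \<inter> pverts G = {}" using disj by blast
    ultimately show ?thesis using component_disjoint_union[OF H G conn(2) _ that] by simp
  qed
  ultimately have sub: "?c ` pverts G \<subseteq> {G}" "?c ` pverts H \<subseteq> {H}" by blast+
  have "pverts G \<noteq> {}" "pverts H \<noteq> {}"
    using conn connected_iff_rtrancl[OF G] connected_iff_rtrancl[OF H] by blast+
  then have "?c ` pverts G = {G}" "?c ` pverts H = {H}"
    using subset_singletonD[OF sub(1)] subset_singletonD[OF sub(2)] by simp_all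
  then have "?c ` (pverts G \<union> pverts H) = {G, H}" unfolding image_Un by auto
  then show ?thesis
    unfolding components_eq_image[OF pair_graph_disjoint_union[OF G H]] by simp
qed

lemma graph_class_pair_graph: "graph_class \<G> \<Longrightarrow> G \<in> \<G> \<Longrightarrow> pair_graph G"
  unfolding graph_class_def by (drule conjunct1) (rule bspec)

text \<open>All graphs of a class share the vertex type \<open>nat\<close>; injective renaming is
  how vertex-disjoint copies are obtained.\<close>

lemma graph_class_image:
  assumes "graph_class \<G>" "G \<in> \<G>" "inj_on f (pverts G)"
  shows "\<lparr> pverts = f ` pverts G, parcs = map_prod f f ` parcs G \<rparr> \<in> \<G>"
proof -
  have G: "pair_graph G" using assms graph_class_pair_graph by blast
  interpret pair_graph G by fact
  let ?h = "\<lparr> iso_verts = f, iso_arcs = map_prod f f, iso_head = snd, iso_tail = fst \<rparr>"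
  have "parcs G \<subseteq> pverts G \<times> pverts G" using in_arcsD1 in_arcsD2 by auto
  then have "inj_on (map_prod f f) (parcs G)"
    using map_prod_inj_on[OF assms(3,3)] inj_on_subset by blast
  then have "digraph_isomorphism ?h"
    unfolding digraph_isomorphism_def using assms(3) wf_digraph_axioms by simp
  moreover have "with_proj \<lparr> pverts = f ` pverts G, parcs = map_prod f f ` parcs G \<rparr> = app_iso ?h (with_proj G)"
    by (simp add: with_proj_def app_iso_def)
  ultimately show ?thesis
    using assms(1,2) unfolding graph_class_def digraph_iso_def by blast
qed

lemma minor_closed_induced:
  assumes "graph_class \<G>" "minor_closed \<G>" "G \<in> \<G>" "S \<subseteq> pverts G"
  shows "induced G S \<in> \<G>"
proof -
  have "minor (induced G S) G"
    by (rule minor_induced[OF graph_class_pair_graph[OF assms(1,3)] assms(4)])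
  then show ?thesis using assms(2,3) unfolding minor_closed_def by blast
qed

subsection \<open>Building the universal pendant graph\<close>

text \<open>A type of rank \<open>k\<close> reads only the set with index \<open>k\<close>, so the
  constant assignment merely places the neighbours of the root there.\<close>

definition block_type :: "nat \<Rightarrow> 'a pair_pre_digraph \<Rightarrow> 'a \<Rightarrow> 'a set \<Rightarrow> nat" where
  "block_type k G r B = ty k k B (parcs G) (\<lambda>_. {v. (r, v) \<in> parcs G})"

text \<open>The type that \<open>H\<close> acquires as a block whose only edge to the root is at
  \<open>w\<close>: then \<open>{w}\<close> is the trace of the root's neighbourhood.\<close>

definition rooted_type :: "nat \<Rightarrow> 'a pair_pre_digraph \<Rightarrow> 'a \<Rightarrow> nat" where
  "rooted_type k H w = ty k k (pverts H) (parcs H) (\<lambda>_. {w})"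

lemma starD:
  assumes "star V R r P"
  shows "finite P" "V = insert r (\<Union>P)" "r \<notin> \<Union>P" "pairwise disjnt P" "sym R" "(r, r) \<notin> R"
    "u \<in> \<Union>P \<Longrightarrow> v \<in> \<Union>P \<Longrightarrow> (u, v) \<in> R \<Longrightarrow> \<exists>B\<in>P. u \<in> B \<and> v \<in> B"
proof -
  note s = assms[unfolded star_def]
  show "finite P" using s by (elim conjE)
  show "V = insert r (\<Union>P)" using s by (elim conjE)
  show "r \<notin> \<Union>P" using s by (elim conjE)
  show "pairwise disjnt P" using s by (elim conjE)
  show "sym R" using s by (elim conjE)
  show "(r, r) \<notin> R" using s by (elim conjE)
  have "\<forall>u\<in>\<Union>P. \<forall>v\<in>\<Union>P. (u, v) \<in> R \<longrightarrow> (\<exists>B\<in>P. u \<in> B \<and> v \<in> B)"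
    using s by (elim conjE)
  then show "u \<in> \<Union>P \<Longrightarrow> v \<in> \<Union>P \<Longrightarrow> (u, v) \<in> R \<Longrightarrow> \<exists>B\<in>P. u \<in> B \<and> v \<in> B"
    by blast
qed

text \<open>A copy of \<open>H\<close> moved off \<open>G\<close> is united with it and then linked
  by an edge from the root to the copy of \<open>w\<close>, which stays inside an addable class. No
  arc meeting an old block changes, and so neither does its type.\<close>

lemma attach:
  assumes cl: "graph_class \<G>" and add: "addable \<G>"
    and G: "G \<in> \<G>" "connected (with_proj G)" "star (pverts G) (parcs G) r P"
    and H: "H \<in> \<G>" "connected (with_proj H)" "w \<in> pverts H"
  shows "\<exists>G' B. G' \<in> \<G> \<and> connected (with_proj G') \<and> star (pverts G') (parcs G') r (insert B P) \<and>
     B \<notin> P \<and> block_type k G' r B = rooted_type k H w \<and>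
     (\<forall>C\<in>P. block_type k G' r C = block_type k G r C)"
proof -
  have pG: "pair_graph G" and pH: "pair_graph H"
    using graph_class_pair_graph[OF cl G(1)] graph_class_pair_graph[OF cl H(1)] .
  note finP = starD(1)[OF G(3)] and V = starD(2)[OF G(3)] and rP = starD(3)[OF G(3)]
    and disj = starD(4)[OF G(3)] and arcs = starD(7)[OF G(3)]
  \<comment> \<open>A bound on the vertices of \<open>G\<close>: shifting \<open>H\<close> by
    \<open>n\<close> moves it clear of \<open>G\<close>.\<close>
  obtain n where n: "\<forall>x\<in>pverts G. x < n"
    using pair_graph_finite[OF pG] unfolding finite_nat_set_iff_bounded ..
  define f where "f x = x + n" for x
  have inj: "inj_on f A" for A by (simp add: f_def inj_on_def)
  have f_eq: "f x = f y \<longleftrightarrow> x = y" for x y by (simp add: f_def)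
  have fG: "f x \<notin> pverts G" for x using bspec[OF n, of "f x"] by (auto simp: f_def)
  have r: "r \<in> pverts G" using V by simp
  then have fr: "f x \<noteq> r" for x using fG by metis
  define K where "K = \<lparr> pverts = f ` pverts H, parcs = map_prod f f ` parcs H \<rparr>"
  have K: "K \<in> \<G>" unfolding K_def using graph_class_image[OF cl H(1) inj] .
  have pK: "pair_graph K" using cl K graph_class_pair_graph by blast
  have vK: "pverts K = f ` pverts H" by (simp add: K_def)
  have aK: "(f u, f v) \<in> parcs K \<longleftrightarrow> (u, v) \<in> parcs H" for u v
    by (auto simp: K_def f_eq intro: image_eqI[of _ "map_prod f f" "(u, v)"])
  have KG: "pverts G \<inter> pverts K = {}" using fG vK by auto
  have reachK: "(f u, f v) \<in> (parcs K)\<^sup>*" if "u \<in> pverts H" "v \<in> pverts H" for u v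
  proof -
    have "(u, v) \<in> (parcs H)\<^sup>*" using H(2) that unfolding connected_iff_rtrancl[OF pH] by blast
    then show ?thesis
    proof induction
      case (step y z)
      then show ?case using aK[of y z] by (auto intro: rtrancl_into_rtrancl)
    qed simp
  qed
  have cK: "connected (with_proj K)"
    using H(3) reachK vK by (intro connectedI_root[OF pK, of "f w"]) auto
  let ?U = "disjoint_union G K"
  have comp: "components ?U = {G, K}"
    by (rule components_disjoint_union[OF pG pK G(2) cK KG])
  then have U: "?U \<in> \<G>"
    using add G(1) K pair_graph_disjoint_union[OF pG pK] unfolding addable_def decomposable_def by simp
  define G' where "G' = add_edge ?U r (f w)"
  have fw: "f w \<in> pverts K" using H(3) vK by simp
  have "G \<noteq> K" using KG r by auto
  moreover have "\<forall>A\<in>components ?U. \<forall>B\<in>components ?U. A \<noteq> B \<longrightarrow>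
        (\<forall>u\<in>pverts A. \<forall>v\<in>pverts B. add_edge ?U u v \<in> \<G>)"
    using add U unfolding addable_def by blast
  ultimately have G': "G' \<in> \<G>" unfolding G'_def using r fw comp by auto
  have pG': "pair_graph G'" using cl G' graph_class_pair_graph by blast
  have vG': "pverts G' = pverts G \<union> pverts K"
    and aG': "parcs G' = parcs G \<union> parcs K \<union> {(r, f w), (f w, r)}"
    by (simp_all add: G'_def add_edge_def)
  have "connected (with_proj G')"
  proof (rule connectedI_root[OF pG', of r])
    show "r \<in> pverts G'" using r vG' by simp
    fix v assume "v \<in> pverts G'"
    then consider "v \<in> pverts G" | x where "x \<in> pverts H" "v = f x" using vG' vK by blast
    then show "(r, v) \<in> (parcs G')\<^sup>*"
    proof cases
      case 1
      then have "(r, v) \<in> (parcs G)\<^sup>*" using G(2) r unfolding connected_iff_rtrancl[OF pG] by blast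
      then show ?thesis by (rule subsetD[OF rtrancl_mono, rotated]) (auto simp: aG')
    next
      case 2
      have "(f w, v) \<in> (parcs K)\<^sup>*" using reachK[OF H(3) 2(1)] 2(2) by simp
      then have "(f w, v) \<in> (parcs G')\<^sup>*" by (rule subsetD[OF rtrancl_mono, rotated]) (auto simp: aG')
      moreover have "(r, f w) \<in> parcs G'" by (simp add: aG')
      ultimately show ?thesis by (meson converse_rtrancl_into_rtrancl)
    qed
  qed
  moreover have PG: "B \<subseteq> pverts G" if "B \<in> P" for B using that V by blast
  have wB: "f w \<notin> B" if "B \<in> P" for B using PG[OF that] fG by blast
  then have "pverts K \<notin> P" using fw by blast
  moreover have "star (pverts G') (parcs G') r (insert (pverts K) P)"
    unfolding star_def
  proof (intro conjI)
    show "finite (insert (pverts K) P)" using finP by simp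
    show "pverts G' = insert r (\<Union> (insert (pverts K) P))" using vG' V by auto
    show "r \<notin> \<Union> (insert (pverts K) P)" using rP KG r by auto
    have "disjnt (pverts K) B" if "B \<in> P" for B using PG[OF that] KG by (auto simp: disjnt_def)
    then show "pairwise disjnt (insert (pverts K) P)"
      using disj by (auto simp: pairwise_insert disjnt_sym)
    show "sym (parcs G')" by (rule sym_parcs[OF pG'])
    show "(r, r) \<notin> parcs G'" by (rule pair_graph_irrefl[OF pG'])
    show "\<forall>u\<in>\<Union> (insert (pverts K) P). \<forall>v\<in>\<Union> (insert (pverts K) P).
       (u, v) \<in> parcs G' \<longrightarrow> (\<exists>B\<in>insert (pverts K) P. u \<in> B \<and> v \<in> B)"
    proof (intro ballI impI)
      fix u v assume uv: "u \<in> \<Union> (insert (pverts K) P)" "v \<in> \<Union> (insert (pverts K) P)"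
        and a: "(u, v) \<in> parcs G'"
      have "u \<noteq> r" "v \<noteq> r" using uv rP KG r by auto
      then consider "(u, v) \<in> parcs G" | "(u, v) \<in> parcs K" using a aG' by auto
      then show "\<exists>B\<in>insert (pverts K) P. u \<in> B \<and> v \<in> B"
      proof cases
        case 1
        have "u \<in> \<Union>P" "v \<in> \<Union>P"
          using pair_graph_arcsD(1,2)[OF pG 1] V \<open>u \<noteq> r\<close> \<open>v \<noteq> r\<close> by auto
        then show ?thesis using arcs 1 by blast
      next
        case 2
        then show ?thesis using pair_graph_arcsD(1,2)[OF pK 2] by blast
      qed
    qed
  qed
  moreover have "block_type k G' r (pverts K) = rooted_type k H w"
    unfolding block_type_def rooted_type_def
  proof (rule ty_iso[symmetric])
    show "bij_betw f (pverts H) (pverts K)" using inj vK by (simp add: bij_betw_def)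
    show "(u, v) \<in> parcs H \<longleftrightarrow> (f u, f v) \<in> parcs G'" for u v
    proof -
      have "(f u, f v) \<notin> parcs G" using pair_graph_arcsD(1)[OF pG] fG by blast
      then show ?thesis using fr aK by (auto simp: aG')
    qed
    show "v \<in> {w} \<longleftrightarrow> f v \<in> {v. (r, v) \<in> parcs G'}" for v
    proof -
      have "(r, f v) \<notin> parcs G" using pair_graph_arcsD(2)[OF pG] fG by blast
      moreover have "(r, f v) \<notin> parcs K" using pair_graph_arcsD(1)[OF pK] KG r by blast
      ultimately show ?thesis using fr f_eq by (auto simp: aG')
    qed
  qed
  moreover have "block_type k G' r C = block_type k G r C" if C: "C \<in> P" for C
    unfolding block_type_def
  proof (rule ty_iso[of id])
    show "bij_betw id C C" by simp
    have notK: "(u, v) \<notin> parcs K" if "v \<in> C" for u v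
      using pair_graph_arcsD(2)[OF pK] KG PG[OF C] that by blast
    have neq: "v \<noteq> r" "v \<noteq> f w" if "v \<in> C" for v using rP C that wB by blast+
    show "(u, v) \<in> parcs G' \<longleftrightarrow> (id u, id v) \<in> parcs G" if "u \<in> C" "v \<in> C" for u v
      using notK[OF that(2)] neq[OF that(1)] neq[OF that(2)] by (simp add: aG')
    show "v \<in> {v. (r, v) \<in> parcs G'} \<longleftrightarrow> id v \<in> {v. (r, v) \<in> parcs G}" if "v \<in> C" for v
      using notK[OF that] neq[OF that] by (simp add: aG')
  qed
  ultimately show ?thesis using G' by blast
qed

lemma card_insert_filter:
  assumes "finite P" "B \<notin> P" "\<And>C. C \<in> P \<Longrightarrow> f C = g C"
  shows "card {C \<in> insert B P. f C = c} = (if f B = c then 1 else 0) + card {C \<in> P. g C = c}"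
proof -
  have "{C \<in> insert B P. f C = c} = (if f B = c then insert B {C \<in> P. g C = c} else {C \<in> P. g C = c})"
    using assms(3) by auto
  then show ?thesis using assms(1,2) by simp
qed

text \<open>One block is attached per entry of \<open>ts\<close>, so the list serves as a multiset
  of types prescribing the multiplicities.\<close>

lemma exists_star_of_types:
  assumes cl: "graph_class \<G>" and add: "addable \<G>" and mc: "minor_closed \<G>"
    and ne: "\<exists>G\<in>\<G>. pverts G \<noteq> {}"
    and ts: "\<And>t. t \<in> set ts \<Longrightarrow>
      \<exists>H\<in>\<G>. connected (with_proj H) \<and> (\<exists>w\<in>pverts H. rooted_type k H w = t)"
  shows "\<exists>G r P. G \<in> \<G> \<and> connected (with_proj G) \<and> star (pverts G) (parcs G) r P \<and>
    (\<forall>c. card {B \<in> P. block_type k G r B = c} = count_list ts c)"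
  using ts
proof (induction ts)
  case Nil
  \<comment> \<open>The bare root is an induced subgraph of any nonempty member of the
    class.\<close>
  obtain G r where G: "G \<in> \<G>" "r \<in> pverts G" using ne by blast
  let ?K = "induced G {r}"
  have K: "?K \<in> \<G>" using G by (intro minor_closed_induced[OF cl mc]) simp_all
  have pK: "pair_graph ?K" by (rule graph_class_pair_graph[OF cl K])
  have "connected (with_proj ?K)" by (rule connectedI_root[OF pK, of r]) simp_all
  moreover have "star (pverts ?K) (parcs ?K) r {}"
    unfolding star_def using sym_parcs[OF pK] pair_graph_irrefl[OF pK, of r] by simp
  ultimately show ?case using K by (intro exI[of _ ?K] exI[of _ r] exI[of _ "{}"]) simp
next
  case (Cons t ts)
  have "\<exists>G r P. G \<in> \<G> \<and> connected (with_proj G) \<and> star (pverts G) (parcs G) r P \<and>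
    (\<forall>c. card {B \<in> P. block_type k G r B = c} = count_list ts c)"
    by (rule Cons.IH) (simp add: Cons.prems)
  then obtain G r P where G: "G \<in> \<G>" "connected (with_proj G)" "star (pverts G) (parcs G) r P"
    and cnt: "\<forall>c. card {B \<in> P. block_type k G r B = c} = count_list ts c" by blast
  obtain H w where H: "H \<in> \<G>" "connected (with_proj H)" "w \<in> pverts H" and t: "rooted_type k H w = t"
    using Cons.prems[of t] by auto
  obtain G' B where G': "G' \<in> \<G>" "connected (with_proj G')" "star (pverts G') (parcs G') r (insert B P)"
    and B: "B \<notin> P" "block_type k G' r B = rooted_type k H w"
      "\<forall>C\<in>P. block_type k G' r C = block_type k G r C"
    using attach[OF cl add G H] by blast
  have "card {C \<in> insert B P. block_type k G' r C = c} = count_list (t # ts) c" for c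
    using card_insert_filter[OF starD(1)[OF G(3)] B(1), of "block_type k G' r" "block_type k G r" c]
      B(2,3) t cnt by simp
  then show ?case using G' by blast
qed

lemma count_list_concat_replicate: "count_list (concat (replicate n xs)) c = n * count_list xs c"
  by (induction n) simp_all

section \<open>Pendant copies as stars\<close>

lemma pendant_copy_arcs:
  assumes "pre_digraph.digraph_isomorphism (with_proj M) h"
    and "induced_subgraph (app_iso h (with_proj M)) (with_proj G)"
  shows "inj_on (iso_verts h) (pverts M)" "iso_verts h ` pverts M \<subseteq> pverts G"
    "\<And>u v. u \<in> pverts M \<Longrightarrow> v \<in> pverts M \<Longrightarrow>
       (u, v) \<in> parcs M \<longleftrightarrow> (iso_verts h u, iso_verts h v) \<in> parcs G"
proof -
  let ?C = "app_iso h (with_proj M)"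
  have wf: "wf_digraph (with_proj M)" and inj: "inj_on (iso_verts h) (pverts M)"
    and ends: "\<And>a. a \<in> parcs M \<Longrightarrow> iso_verts h (fst a) = iso_tail h (iso_arcs h a) \<and>
      iso_verts h (snd a) = iso_head h (iso_arcs h a)"
    using assms(1) by (auto simp: pre_digraph.digraph_isomorphism_def)
  have sub: "verts ?C \<subseteq> pverts G" and comp: "tail ?C = fst" "head ?C = snd"
    and arcs: "arcs ?C = {e \<in> parcs G. fst e \<in> verts ?C \<and> snd e \<in> verts ?C}"
    using assms(2) by (simp_all add: induced_subgraph_def subgraph_def compatible_def)
  show "inj_on (iso_verts h) (pverts M)" by (rule inj)
  show "iso_verts h ` pverts M \<subseteq> pverts G" using sub by simp
  \<comment> \<open>A library isomorphism has an arc map and end maps of its own; compatibility with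
    \<open>G\<close>, whose ends are \<open>fst\<close> and \<open>snd\<close>, forces the arc map
    to act as the vertex map on both ends.\<close>
  have arc: "iso_arcs h a = (iso_verts h (fst a), iso_verts h (snd a))" if "a \<in> parcs M" for a
    using ends[OF that] comp by (simp add: prod_eq_iff)
  fix u v assume uv: "u \<in> pverts M" "v \<in> pverts M"
  show "(u, v) \<in> parcs M \<longleftrightarrow> (iso_verts h u, iso_verts h v) \<in> parcs G"
  proof
    assume a: "(u, v) \<in> parcs M"
    then have "iso_arcs h (u, v) \<in> arcs ?C" by simp
    then show "(iso_verts h u, iso_verts h v) \<in> parcs G" unfolding arcs using arc[OF a] by simp
  next
    assume "(iso_verts h u, iso_verts h v) \<in> parcs G"
    then have "(iso_verts h u, iso_verts h v) \<in> arcs ?C" unfolding arcs using uv by simp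
    then obtain a where a: "a \<in> parcs M" "iso_arcs h a = (iso_verts h u, iso_verts h v)" by auto
    have "fst a \<in> pverts M" "snd a \<in> pverts M"
      using wf_digraph.tail_in_verts[OF wf] wf_digraph.head_in_verts[OF wf] a(1) by simp_all
    moreover have "iso_verts h (fst a) = iso_verts h u" "iso_verts h (snd a) = iso_verts h v"
      using arc[OF a(1)] a(2) by simp_all
    ultimately have "fst a = u" "snd a = v" using inj uv by (simp_all add: inj_on_eq_iff)
    then show "(u, v) \<in> parcs M" using a(1) by (metis prod.collapse)
  qed
qed

text \<open>Until \<open>w\<close> is reached inside \<open>W\<close>, the walk cannot leave
  \<open>W\<close>; once \<open>w\<close> is reached, the first alternative holds for good.\<close>

lemma rtrancl_leaving_through:
  assumes "(x, y) \<in> R\<^sup>*" "x \<in> W"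
    and "\<And>u v. (u, v) \<in> R \<Longrightarrow> u \<in> W \<Longrightarrow> v \<notin> W \<Longrightarrow> u = w"
  shows "(x, w) \<in> {(u, v) \<in> R. u \<in> W \<and> v \<in> W}\<^sup>* \<or> y \<in> W \<and> (x, y) \<in> {(u, v) \<in> R. u \<in> W \<and> v \<in> W}\<^sup>*"
  using assms(1)
proof induction
  case base
  then show ?case using assms(2) by simp
next
  case (step y z)
  show ?case
  proof (cases "(x, w) \<in> {(u, v) \<in> R. u \<in> W \<and> v \<in> W}\<^sup>*")
    case False
    then have y: "y \<in> W" "(x, y) \<in> {(u, v) \<in> R. u \<in> W \<and> v \<in> W}\<^sup>*" using step.IH by simp_all
    then have "y \<noteq> w" using False by blast
    then have "z \<in> W" using assms(3)[OF step.hyps(2) y(1)] by blast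
    then have "(y, z) \<in> {(u, v) \<in> R. u \<in> W \<and> v \<in> W}" using y(1) step.hyps(2) by simp
    then show ?thesis using y(2) \<open>z \<in> W\<close> by (meson rtrancl_into_rtrancl)
  qed simp
qed

text \<open>For a walk to \<open>w\<close> itself both alternatives of
  \<open>rtrancl_leaving_through\<close> provide a walk inside \<open>W\<close>.\<close>

lemma connected_induced_outside:
  assumes G: "pair_graph G" and conn: "connected (with_proj G)" and W: "W \<subseteq> pverts G" "w \<in> W"
    and leave: "\<And>u v. (u, v) \<in> parcs G \<Longrightarrow> u \<in> W \<Longrightarrow> v \<notin> W \<Longrightarrow> u = w"
  shows "connected (with_proj (induced G W))"
proof (rule connectedI_root)
  show pW: "pair_graph (induced G W)" by (rule pair_graph_induced[OF G W(1)])
  show "w \<in> pverts (induced G W)" using W(2) by simp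
  fix v assume "v \<in> pverts (induced G W)"
  then have v: "v \<in> W" by simp
  have "(v, w) \<in> (parcs G)\<^sup>*" using conn v W unfolding connected_iff_rtrancl[OF G] by blast
  then have "(v, w) \<in> {(x, y) \<in> parcs G. x \<in> W \<and> y \<in> W}\<^sup>*"
    using rtrancl_leaving_through[of v w "parcs G" W w] v leave by blast
  then have "(v, w) \<in> (parcs (induced G W))\<^sup>*" by (simp add: induced_def)
  then show "(w, v) \<in> (parcs (induced G W))\<^sup>*"
    using sym_rtrancl[OF sym_parcs[OF pW]] by (meson symD)
qed

text \<open>The blocks of \<open>G\<close> around the root of the copy are the images of the blocks
  of \<open>M\<close> and the remainder \<open>W\<close>. That only one edge leaves the copy makes
  \<open>W\<close> connected, separates it from the other blocks, and leaves \<open>w\<close> as the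
  root's sole neighbour in \<open>W\<close>, so \<open>W\<close> has the type of a rooted member of
  the class.\<close>

lemma pendant_copy_star:
  assumes cl: "graph_class \<G>" and mc: "minor_closed \<G>"
    and star: "star (pverts M) (parcs M) r P"
    and G: "G \<in> \<G>" "connected (with_proj G)" and pend: "contains_pendant_copy G M r"
  shows "\<exists>f W H w. star (pverts G) (parcs G) (f r) (insert W ((`) f ` P)) \<and> W \<notin> (`) f ` P \<and> inj_on ((`) f) P \<and>
    (\<forall>B\<in>P. block_type k G (f r) (f ` B) = block_type k M r B) \<and>
    H \<in> \<G> \<and> connected (with_proj H) \<and> w \<in> pverts H \<and> block_type k G (f r) W = rooted_type k H w"
proof -
  have pG: "pair_graph G" by (rule graph_class_pair_graph[OF cl G(1)])
  obtain h w where iso: "pre_digraph.digraph_isomorphism (with_proj M) h"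
    and ind: "induced_subgraph (app_iso h (with_proj M)) (with_proj G)"
    and out: "{(x, y) \<in> parcs G. x \<in> verts (app_iso h (with_proj M)) \<and> y \<notin> verts (app_iso h (with_proj M))} =
      {(iso_verts h r, w)}"
    using pend unfolding contains_pendant_copy_def by blast
  define f where "f = iso_verts h"
  note h = pendant_copy_arcs[OF iso ind, folded f_def]
  define C where "C = f ` pverts M"
  have C: "C \<subseteq> pverts G" using h(2) by (simp add: C_def)
  have out': "(x, y) \<in> parcs G \<and> x \<in> C \<and> y \<notin> C \<longleftrightarrow> x = f r \<and> y = w" for x y
    using out by (simp add: set_eq_iff C_def f_def)
  define W where "W = pverts G - C"
  have fr: "(f r, w) \<in> parcs G" "f r \<in> C" "w \<notin> C" using out'[of "f r" w] by simp_all
  then have w: "w \<in> W" using pair_graph_arcsD(2)[OF pG fr(1)] by (simp add: W_def)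
  have WG: "W \<subseteq> pverts G" by (auto simp: W_def)
  \<comment> \<open>Arcs leaving \<open>W\<close> are the reversals of arcs leaving the copy, of
    which there is one.\<close>
  have leave: "u = w \<and> v = f r" if "(u, v) \<in> parcs G" "u \<in> W" "v \<notin> W" for u v
  proof -
    have "(v, u) \<in> parcs G" "v \<in> C" "u \<notin> C"
      using that pair_graph_arcsD[OF pG that(1)] by (simp_all add: W_def)
    then show ?thesis using out'[of v u] by simp
  qed
  have H: "induced G W \<in> \<G>" by (rule minor_closed_induced[OF cl mc G(1) WG])
  have cH: "connected (with_proj (induced G W))"
    using leave by (intro connected_induced_outside[OF pG G(2) WG w]) blast
  note finP = starD(1)[OF star] and V = starD(2)[OF star] and rP = starD(3)[OF star]
    and disj = starD(4)[OF star] and arcs = starD(7)[OF star]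
  have PM: "B \<subseteq> pverts M" if "B \<in> P" for B using that V by blast
  have rM: "r \<in> pverts M" using V by simp
  have CP: "C = insert (f r) (\<Union>((`) f ` P))" unfolding C_def V by auto
  have frP: "f r \<notin> \<Union>((`) f ` P)"
  proof
    assume "f r \<in> \<Union>((`) f ` P)"
    then obtain B x where "B \<in> P" "x \<in> B" "f r = f x" by auto
    then have "r = x" using inj_onD[OF h(1)] rM PM by blast
    then show False using rP \<open>B \<in> P\<close> \<open>x \<in> B\<close> by blast
  qed
  have W_out: "x \<notin> W" if "x \<in> C" for x using that by (simp add: W_def)
  have "f ` B \<subseteq> C" if "B \<in> P" for B using PM[OF that] by (auto simp: C_def)
  then have WP: "disjnt W (f ` B)" if "B \<in> P" for B using that W_out by (auto simp: disjnt_iff)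
  \<comment> \<open>\<open>W\<close> contains \<open>w\<close>, so being disjoint from a block makes
    it a different set.\<close>
  have WnP: "W \<notin> (`) f ` P" using WP w by (auto simp: disjnt_iff)
  \<comment> \<open>Blocks are counted as sets, so distinct blocks of \<open>M\<close> must have
    distinct images for the counts to carry over.\<close>
  have injP: "inj_on ((`) f) P"
    using inj_on_image_eq_iff[OF h(1)] PM by (intro inj_onI) blast
  have dP: "disjnt (f ` A) (f ` B)" if "A \<in> P" "B \<in> P" "f ` A \<noteq> f ` B" for A B
  proof -
    have "A \<noteq> B" using that(3) by blast
    then have "A \<inter> B = {}" using pairwiseD[OF disj that(1,2)] by (simp add: disjnt_def)
    then show ?thesis
      using inj_on_image_Int[OF h(1) PM[OF that(1)] PM[OF that(2)]] by (simp add: disjnt_def)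
  qed
  have "star (pverts G) (parcs G) (f r) (insert W ((`) f ` P))"
    unfolding star_def
  proof (intro conjI)
    show "finite (insert W ((`) f ` P))" using finP by simp
    have "pverts G = C \<union> W" using C by (auto simp: W_def)
    then show "pverts G = insert (f r) (\<Union>(insert W ((`) f ` P)))" using CP by auto
    show "f r \<notin> \<Union>(insert W ((`) f ` P))" using frP W_out[OF fr(2)] by simp
    have "pairwise disjnt ((`) f ` P)" using dP by (auto simp: pairwise_def)
    then show "pairwise disjnt (insert W ((`) f ` P))"
      using WP by (auto simp: pairwise_insert disjnt_sym)
    show "sym (parcs G)" by (rule sym_parcs[OF pG])
    show "(f r, f r) \<notin> parcs G" by (rule pair_graph_irrefl[OF pG])
    show "\<forall>u\<in>\<Union>(insert W ((`) f ` P)). \<forall>v\<in>\<Union>(insert W ((`) f ` P)).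
       (u, v) \<in> parcs G \<longrightarrow> (\<exists>B\<in>insert W ((`) f ` P). u \<in> B \<and> v \<in> B)"
    proof (intro ballI impI)
      fix u v assume uv: "u \<in> \<Union>(insert W ((`) f ` P))" "v \<in> \<Union>(insert W ((`) f ` P))"
        and a: "(u, v) \<in> parcs G"
      have neq: "u \<noteq> f r" "v \<noteq> f r" using uv frP W_out[OF fr(2)] by auto
      have a': "(v, u) \<in> parcs G" by (rule pair_graph_arcsD(4)[OF pG a])
      consider "u \<in> W" | "v \<in> W" | "u \<in> \<Union>((`) f ` P)" "v \<in> \<Union>((`) f ` P)" using uv by auto
      then show "\<exists>B\<in>insert W ((`) f ` P). u \<in> B \<and> v \<in> B"
      proof cases
        case 1
        then show ?thesis using leave[OF a] neq by blast
      next
        case 2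
        then show ?thesis using leave[OF a'] neq by blast
      next
        case 3
        then obtain A B x y where x: "A \<in> P" "x \<in> A" "u = f x" and y: "B \<in> P" "y \<in> B" "v = f y" by auto
        have "(x, y) \<in> parcs M" using h(3)[of x y] PM x y a by blast
        then obtain D where "D \<in> P" "x \<in> D" "y \<in> D" using arcs[of x y] x y by blast
        then show ?thesis using x(3) y(3) by blast
      qed
    qed
  qed
  moreover have "block_type k G (f r) (f ` B) = block_type k M r B" if B: "B \<in> P" for B
    unfolding block_type_def
  proof (rule ty_iso[symmetric])
    show "bij_betw f B (f ` B)" using inj_on_subset[OF h(1) PM[OF B]] by (rule inj_on_imp_bij_betw)
    show "(u, v) \<in> parcs M \<longleftrightarrow> (f u, f v) \<in> parcs G" if "u \<in> B" "v \<in> B" for u v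
      using h(3) PM[OF B] that by blast
    show "v \<in> {v. (r, v) \<in> parcs M} \<longleftrightarrow> f v \<in> {v. (f r, v) \<in> parcs G}" if "v \<in> B" for v
      using h(3)[OF rM] PM[OF B] that by blast
  qed
  moreover have "block_type k G (f r) W = rooted_type k (induced G W) w"
    unfolding block_type_def rooted_type_def
  proof (rule ty_iso[of id])
    show "v \<in> {v. (f r, v) \<in> parcs G} \<longleftrightarrow> id v \<in> {w}" if "v \<in> W" for v
      using out'[of "f r" v] fr that by (auto simp: W_def)
  qed simp_all
  ultimately show ?thesis using WnP injP H cH w
    by (intro exI[of _ f] exI[of _ W] exI[of _ "induced G W"] exI[of _ w]) simp
qed

theorem theorem3p1:
  fixes \<G> :: "nat pair_pre_digraph set" and k :: nat
  assumes "graph_class \<G>" and "\<exists>G\<in>\<G>. pverts G \<noteq> {}"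
    and "addable \<G>" and "minor_closed \<G>"
  shows "\<exists>M r. M \<in> \<G> \<and> r \<in> pverts M \<and> connected (with_proj M) \<and>
    (\<forall>G\<in>\<G>. connected (with_proj G) \<and> contains_pendant_copy G M r \<longrightarrow> mso_equiv k G M)"
proof -
  note cl = assms(1) and ne = assms(2) and add = assms(3) and mc = assms(4)
  \<comment> \<open>Only types realised in the class are included: these are what
    \<open>attach\<close> can supply, and the remainder of any \<open>G\<close> has one of
    them.\<close>
  define T where "T = {rooted_type k H w | H w. H \<in> \<G> \<and> connected (with_proj H) \<and> w \<in> pverts H}"
  have "T \<subseteq> types k k" unfolding T_def rooted_type_def by (auto simp: ty_in_types)
  then have "finite T" using finite_types by (rule finite_subset)
  then obtain xs where xs: "set xs = T" using finite_list by blast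
  \<comment> \<open>\<open>threshold k k\<close> repetitions lift each type of \<open>T\<close> to
    the point where counts cease to be distinguished.\<close>
  let ?ts = "concat (replicate (threshold k k) xs)"
  have "\<exists>H\<in>\<G>. connected (with_proj H) \<and> (\<exists>w\<in>pverts H. rooted_type k H w = t)" if "t \<in> set ?ts" for t
  proof -
    have "t \<in> T" using that xs by (auto simp: set_replicate_conv_if split: if_splits)
    then show ?thesis unfolding T_def by blast
  qed
  from exists_star_of_types[OF cl add mc ne this]
  obtain M r P where M: "M \<in> \<G>" "connected (with_proj M)" "star (pverts M) (parcs M) r P"
    and cnt: "\<forall>c. card {B \<in> P. block_type k M r B = c} = count_list ?ts c" by blast
  have many: "threshold k k \<le> card {B \<in> P. block_type k M r B = c}" if "c \<in> T" for c
  proof -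
    have "count_list xs c \<noteq> 0" using that xs by (simp add: count_list_0_iff)
    then show ?thesis using cnt by (simp add: count_list_concat_replicate)
  qed
  have "mso_equiv k G M"
    if G: "G \<in> \<G>" "connected (with_proj G)" and pend: "contains_pendant_copy G M r" for G
  proof -
    obtain f W H w where sG: "star (pverts G) (parcs G) (f r) (insert W ((`) f ` P))"
      and W: "W \<notin> (`) f ` P" and inj: "inj_on ((`) f) P"
      and old: "\<forall>B\<in>P. block_type k G (f r) (f ` B) = block_type k M r B"
      and H: "H \<in> \<G>" "connected (with_proj H)" "w \<in> pverts H"
        "block_type k G (f r) W = rooted_type k H w"
      using pendant_copy_star[OF cl mc M(3) G pend, of k] by blast
    have WT: "block_type k G (f r) W \<in> T" unfolding T_def using H by blast
    have "card {C \<in> (`) f ` P. block_type k G (f r) C = c} = card {B \<in> P. block_type k M r B = c}" for c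
    proof -
      have "{C \<in> (`) f ` P. block_type k G (f r) C = c} = (`) f ` {B \<in> P. block_type k M r B = c}"
        using old by auto
      moreover have "inj_on ((`) f) {B \<in> P. block_type k M r B = c}"
        using inj by (rule inj_on_subset) blast
      ultimately show ?thesis by (simp add: card_image)
    qed
    then have "card {C \<in> insert W ((`) f ` P). block_type k G (f r) C = c} =
        (if block_type k G (f r) W = c then 1 else 0) + card {B \<in> P. block_type k M r B = c}" for c
      using card_insert_filter[OF _ W, of "block_type k G (f r)" "block_type k G (f r)" c]
        starD(1)[OF M(3)] by simp
    \<comment> \<open>Only the type of \<open>W\<close> gains a block, and its count has reached the
      threshold on both sides.\<close>
    then have "matched (threshold k k) (insert W ((`) f ` P)) (block_type k G (f r)) P (block_type k M r)"
      unfolding matched_def eq_upto_def using many WT by (auto intro: le_SucI)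
    \<comment> \<open>Neither root lies in its own neighbourhood, as there are no loops; so the
      roots agree on the set with index \<open>k\<close>.\<close>
    then have "ty k k (pverts G) (parcs G) (\<lambda>_. {v. (f r, v) \<in> parcs G}) =
        ty k k (pverts M) (parcs M) (\<lambda>_. {v. (r, v) \<in> parcs M})"
      using starD(6)[OF sG] starD(6)[OF M(3)] unfolding block_type_def
      by (intro ty_star[OF sG M(3)]) simp_all
    then show ?thesis by (rule ty_eq_imp_mso_equiv)
  qed
  moreover have "r \<in> pverts M" using starD(2)[OF M(3)] by simp
  ultimately show ?thesis using M by blast
qed

end
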